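(* Let $\mathbb{V}$ be a game mapping that satisfies the dynamic programming principle on $\mathfrak{D}$, let $\mathcal{V}[\varrho]:=\mathbb{V}\big[c[\varrho]\big]$ for $\varrho\in\mathfrak{D}$, and let $U_*:\Omega\to[0,1]$ be an arbitrary function. Then the following conditions are equivalent: (c) for every density $\mu\in\mathfrak{D}$ that is piecewise continuous on $(0,\infty)$, $\lim_{\lambda\to+0}\sup_{\omega\in\Omega}\big|\mathcal{V}[\mu^\lambda_{\mathrm{scale}}](\omega)-U_*(\omega)\big|=0$; (u) $\lim_{T\to+\infty}\sup_{\omega\in\Omega}\big|\mathcal{V}[\varpi_T](\omega)-U_*(\omega)\big|=0$; (e) $\lim_{\lambda\to+0}\sup_{\omega\in\Omega}\big|\mathcal{V}[\pi_\lambda](\omega)-U_*(\omega)\big|=0$; (p) for some power density $\varrho\in\mathfrak{D}$, $\lim_{T\to+\infty}\sup_{\omega\in\Omega}\big|\mathcal{V}[\varrho^T_{\mathrm{shift}}](\omega)-U_*(\omega)\big|=0$; (q) for every power density $\varrho\in\mathfrak{D}$, $\lim_{T\to+\infty}\sup_{\omega\in\Omega}\big|\mathcal{V}[\varrho^T_{\mathrm{shift}}](\omega)-U_*(\omega)\big|=0$. In particular, if for some density $\mu\in\mathfrak{D}$ piecewise continuous on $(0,\infty)$ and some power density $\varrho\in\mathfrak{D}$ at least one of the first three limits among $\lim_{T\to+\infty}\mathcal{V}[\varpi_T]$, $\lim_{\lambda\to+0}\mathcal{V}[\pi_\lambda]$, $\lim_{T\to+\infty}\mathcal{V}[\varrho^T_{\mathrm{shift}}]$,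 $\lim_{\lambda\to+0}\mathcal{V}[\mu^\lambda_{\mathrm{scale}}]$ exists and is uniform on $\Omega$, then all four of these limits exist, are uniform on $\Omega$, coincide, and do not depend on the choice of such $\mu$ and $\varrho$.
   Context: $\mathbb{R}_+=[0,\infty)$. Fix a nonempty set $\Omega$, a nonempty set $\mathbb{K}$ of maps $\mathbb{R}_+\to\Omega$, and a map $g:\Omega\to[0,1]$ such that $t\mapsto g(z(t))$ is Lebesgue measurable for every $z\in\mathbb{K}$. Let $\mathfrak{C}$ be the set of all bounded maps $\mathbb{K}\to\mathbb{R}$ and $\mathfrak{U}$ the set of all bounded maps $\Omega\to\mathbb{R}$. A game mapping is a map $\mathbb{V}:\mathfrak{C}\to\mathfrak{U}$ such that $\mathbb{V}[Ac+B]=A\mathbb{V}[c]+B$ for all $c\in\mathfrak{C}$, $A\ge0$, $B\in\mathbb{R}$, and such that $c_1(z)\le c_2(z)$ for all $z\in\mathbb{K}$ implies $\mathbb{V}[c_1](\omega)\le\mathbb{V}[c_2](\omega)$ for all $\omega\in\Omega$. $\mathfrak{D}$ is the set of probability densities supported in $\mathbb{R}_+$ (Lebesgue integrable $\varrho:\mathbb{R}_+\to\mathbb{R}_+$ with $\int_0^\infty\varrho=1$). For $\varrho\in\mathfrak{D}$ and $T>0$ with $\int_T^\infty\varrho(t)dt>0$, $\varrho^T_{\mathrm{shift}}(t):=\varrho(t+T)/\int_T^\infty\varrho(s)ds$; for $\lambda>0$, $\varrho^\lambda_{\mathrm{scale}}(t):=\lambda\varrho(\lambda t)$. For $\varrho\in\mathfrak{D}$,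 $c[\varrho](z):=\int_0^\infty\varrho(t)g(z(t))dt$, $z\in\mathbb{K}$. For $\varrho\in\mathfrak{D}$, $T>0$ with $\int_T^\infty\varrho>0$, define $d[\varrho,T](z):=\int_0^T\varrho(t)g(z(t))dt+\int_T^\infty\varrho(t)dt\cdot\mathbb{V}\big[c[\varrho^T_{\mathrm{shift}}]\big](z(T))$. $\mathbb{V}$ satisfies the dynamic programming principle on $\mathfrak{D}$ if $\mathbb{V}[d[\varrho,T]]=\mathbb{V}[c[\varrho]]$ for all $\varrho\in\mathfrak{D}$, $T>0$ with $\int_T^\infty\varrho>0$. Densities: $\varpi_T(t)=\frac1T1_{[0,T]}(t)$, $\pi_\lambda(t)=\lambda e^{-\lambda t}$ ($T,\lambda>0$). A density $\varrho\in\mathfrak{D}$ is a power density if $\varrho(t)=(\alpha+\beta t)^{-\gamma}$ for all $t\ge0$ for some $\alpha,\beta,\gamma>0$. *)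

theory Defs
  imports "HOL-Analysis.Analysis"
begin

text \<open>Omega is the type 'w; the set of trajectories K is a set of maps real => 'w
  (only their values on [0,oo) matter).  Bounded maps K -> R are represented by
  functions on (real => 'w) that are bounded on K.\<close>

definition game_mapping ::
  "(real \<Rightarrow> 'w) set \<Rightarrow> (((real \<Rightarrow> 'w) \<Rightarrow> real) \<Rightarrow> 'w \<Rightarrow> real) \<Rightarrow> bool" where
  "game_mapping K V \<longleftrightarrow>
     (\<forall>c. bounded (c ` K) \<longrightarrow> bounded (range (V c))) \<and>
     (\<forall>c A B. bounded (c ` K) \<and> A \<ge> 0 \<longrightarrow>
        V (\<lambda>z. A * c z + B) = (\<lambda>\<omega>. A * V c \<omega> + B)) \<and>
     (\<forall>c1 c2. bounded (c1 ` K) \<and> bounded (c2 ` K) \<and> (\<forall>z\<in>K. c1 z \<le> c2 z) \<longrightarrow>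
        (\<forall>\<omega>. V c1 \<omega> \<le> V c2 \<omega>))"

text \<open>Probability densities supported in [0,oo) (values at negative arguments are irrelevant).\<close>
definition is_density :: "(real \<Rightarrow> real) \<Rightarrow> bool" where
  "is_density \<rho> \<longleftrightarrow> (\<forall>t\<ge>0. \<rho> t \<ge> 0) \<and> set_integrable lebesgue {0..} \<rho> \<and>
     (LINT t:{0..}|lebesgue. \<rho> t) = 1"

definition tail :: "(real \<Rightarrow> real) \<Rightarrow> real \<Rightarrow> real" where
  "tail \<rho> T = (LINT t:{T..}|lebesgue. \<rho> t)"

definition shift :: "(real \<Rightarrow> real) \<Rightarrow> real \<Rightarrow> real \<Rightarrow> real" where
  "shift \<rho> T = (\<lambda>t. \<rho> (t + T) / tail \<rho> T)"

definition scale :: "(real \<Rightarrow> real) \<Rightarrow> real \<Rightarrow> real \<Rightarrow> real" where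
  "scale \<rho> l = (\<lambda>t. l * \<rho> (l * t))"

definition cost :: "('w \<Rightarrow> real) \<Rightarrow> (real \<Rightarrow> real) \<Rightarrow> (real \<Rightarrow> 'w) \<Rightarrow> real" where
  "cost g \<rho> = (\<lambda>z. LINT t:{0..}|lebesgue. \<rho> t * g (z t))"

definition dcost ::
  "('w \<Rightarrow> real) \<Rightarrow> (((real \<Rightarrow> 'w) \<Rightarrow> real) \<Rightarrow> 'w \<Rightarrow> real) \<Rightarrow> (real \<Rightarrow> real) \<Rightarrow> real
     \<Rightarrow> (real \<Rightarrow> 'w) \<Rightarrow> real" where
  "dcost g V \<rho> T = (\<lambda>z. (LINT t:{0..T}|lebesgue. \<rho> t * g (z t))
                         + tail \<rho> T * V (cost g (shift \<rho> T)) (z T))"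

definition DPP ::
  "('w \<Rightarrow> real) \<Rightarrow> (((real \<Rightarrow> 'w) \<Rightarrow> real) \<Rightarrow> 'w \<Rightarrow> real) \<Rightarrow> bool" where
  "DPP g V \<longleftrightarrow> (\<forall>\<rho> T. is_density \<rho> \<and> T > 0 \<and> tail \<rho> T > 0 \<longrightarrow>
                     V (dcost g V \<rho> T) = V (cost g \<rho>))"

definition val ::
  "('w \<Rightarrow> real) \<Rightarrow> (((real \<Rightarrow> 'w) \<Rightarrow> real) \<Rightarrow> 'w \<Rightarrow> real) \<Rightarrow> (real \<Rightarrow> real) \<Rightarrow> 'w \<Rightarrow> real" where
  "val g V \<rho> = V (cost g \<rho>)"

definition unif_avg :: "real \<Rightarrow> real \<Rightarrow> real" where
  "unif_avg T = (\<lambda>t. indicator {0..T} t / T)"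

definition expd :: "real \<Rightarrow> real \<Rightarrow> real" where
  "expd l = (\<lambda>t. l * exp (- l * t))"

definition power_density :: "(real \<Rightarrow> real) \<Rightarrow> bool" where
  "power_density \<rho> \<longleftrightarrow> is_density \<rho> \<and>
     (\<exists>\<alpha> \<beta> \<gamma>::real. \<alpha> > 0 \<and> \<beta> > 0 \<and> \<gamma> > 0 \<and> (\<forall>t\<ge>0. \<rho> t = (\<alpha> + \<beta> * t) powr (- \<gamma>)))"

definition pw_continuous_pos :: "(real \<Rightarrow> real) \<Rightarrow> bool" where
  "pw_continuous_pos f \<longleftrightarrow>
     (\<forall>a b. 0 < a \<and> a < b \<longrightarrow> (\<exists>S. finite S \<and> (\<forall>x\<in>{a..b} - S. isCont f x))) \<and>
     (\<forall>x>0. (\<exists>l. (f \<longlongrightarrow> l) (at_left x)) \<and> (\<exists>l. (f \<longlongrightarrow> l) (at_right x)))"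

definition unif_lim :: "'s filter \<Rightarrow> ('s \<Rightarrow> 'w \<Rightarrow> real) \<Rightarrow> ('w \<Rightarrow> real) \<Rightarrow> bool" where
  "unif_lim F f U \<longleftrightarrow> ((\<lambda>s. SUP \<omega>. \<bar>f s \<omega> - U \<omega>\<bar>) \<longlongrightarrow> 0) F"

end

theory Submission
  imports Defs
begin

text \<open>
  A game mapping is nonexpansive for the supremum norm, so the value of a density is Lipschitz for the
  \<open>L\<^sup>1\<close> distance. Uniform, exponential and shifted power densities are the rescalings of a single
  density \<open>\<mu>\<close> that is self-similar: a shift of \<open>\<mu>\<close> is again a rescaling of \<open>\<mu>\<close>. If the values of the
  rescalings of \<open>\<mu>\<close> converge uniformly to \<open>U\<close>, apply dynamic programming at the time \<open>T\<close> at which \<open>\<mu>\<close>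
  has used up mass \<open>h\<close>. Until then the density is constant up to an \<open>L\<^sup>1\<close> error \<open>C h\<^sup>2\<close>, so the value of
  the mixed payoff ``\<open>h\<close> times the mean of \<open>g\<close> over \<open>[0,T]\<close> plus \<open>(1 - h) U(z(T))\<close>'' differs from \<open>U\<close>
  by at most \<open>C h\<^sup>2 + o(1)\<close>.

  Conversely, cut a density into \<open>N\<close> cells of equal length and apply dynamic programming cell by cell.
  The error made on a cell enters with the mass that remains at its start. For a uniform density the
  cells use up the fractions \<open>1/N, 1/(N-1), \<dots>\<close> of the remaining mass, the accumulated error is of order
  \<open>C ln N / N\<close>, and the uniform averages converge to \<open>U\<close>. As \<open>C = 0\<close> for uniform densities, the mixed
  payoffs now have no asymptotic error, so for an arbitrary density only its \<open>L\<^sup>1\<close> distance to its cell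
  averages remains, which is small because continuous functions are dense in \<open>L\<^sup>1\<close>.
\<close>

section \<open>Set integrals\<close>

lemma
  fixes f :: "real \<Rightarrow> 'a::euclidean_space"
  assumes "c > 0" and mem_iff: "\<And>t. t \<in> B \<longleftrightarrow> s + c * t \<in> A"
  shows set_integrable_affine:
      "set_integrable lebesgue A f \<Longrightarrow> set_integrable lebesgue B (\<lambda>t. f (s + c * t))"
    and set_integral_affine:
      "c *\<^sub>R (LINT t:B|lebesgue. f (s + c * t)) = (LINT t:A|lebesgue. f t)"
proof -
  have indicator_eq: "indicat_real B t = indicator A (s + c * t)" for t
    using mem_iff by (simp add: indicator_def)
  show "set_integrable lebesgue A f \<Longrightarrow> set_integrable lebesgue B (\<lambda>t. f (s + c * t))"
    using \<open>c > 0\<close> lebesgue_integrable_real_affine_iff[of c "\<lambda>t. indicator A t *\<^sub>R f t" s]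
    by (simp add: set_integrable_def indicator_eq)
  show "c *\<^sub>R (LINT t:B|lebesgue. f (s + c * t)) = (LINT t:A|lebesgue. f t)"
    using \<open>c > 0\<close> lebesgue_integral_real_affine[of c "\<lambda>t. indicator A t *\<^sub>R f t" s]
    by (simp add: set_lebesgue_integral_def indicator_eq)
qed

lemma set_integral_nonneg:
  fixes f :: "'a \<Rightarrow> real"
  assumes "\<And>x. x \<in> A \<Longrightarrow> f x \<ge> 0"
  shows "(LINT x:A|M. f x) \<ge> 0"
  unfolding set_lebesgue_integral_def
  by (rule integral_nonneg_AE) (use assms in \<open>auto simp: indicator_def\<close>)

lemma set_integral_mono_set:
  fixes f :: "'a \<Rightarrow> real"
  assumes "set_integrable M B f" "A \<in> sets M" "A \<subseteq> B" "\<And>x. x \<in> B \<Longrightarrow> f x \<ge> 0"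
  shows "(LINT x:A|M. f x) \<le> (LINT x:B|M. f x)"
  unfolding set_lebesgue_integral_def
proof (rule integral_mono)
  show "integrable M (\<lambda>x. indicat_real A x *\<^sub>R f x)"
    using set_integrable_subset[OF assms(1-3)] by (simp add: set_integrable_def)
qed (use assms in \<open>auto simp: set_integrable_def indicator_def\<close>)

lemma set_integral_split_at:
  fixes f :: "real \<Rightarrow> 'a::{banach, second_countable_topology}"
  assumes integrable: "set_integrable lebesgue A f" and A: "A \<in> sets lebesgue"
  shows "(LINT t:A|lebesgue. f t) = (LINT t:A \<inter> {..b}|lebesgue. f t) + (LINT t:A \<inter> {b..}|lebesgue. f t)"
proof -
  have "A = A \<inter> {..b} \<union> A \<inter> {b<..}" by auto
  moreover have "(LINT t:A \<inter> {..b} \<union> A \<inter> {b<..}|lebesgue. f t)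
      = (LINT t:A \<inter> {..b}|lebesgue. f t) + (LINT t:A \<inter> {b<..}|lebesgue. f t)"
    by (rule set_integral_Un) (use A in \<open>auto intro!: set_integrable_subset[OF integrable]\<close>)
  moreover have "(LINT t:A \<inter> {b<..}|lebesgue. f t) = (LINT t:A \<inter> {b..}|lebesgue. f t)"
    by (rule set_integral_discrete_difference[where X = "{b}"]) auto
  ultimately show ?thesis by simp
qed

lemma set_integral_abs_diff_tendsto_0:
  fixes f w :: "'a \<Rightarrow> real"
  assumes A: "A \<in> sets M" and f: "f \<in> borel_measurable M" and s: "\<And>n. s n \<in> borel_measurable M"
    and w: "set_integrable M A w" "\<And>n x. x \<in> A \<Longrightarrow> \<bar>s n x - f x\<bar> \<le> w x"
    and lim: "AE x in M. x \<in> A \<longrightarrow> (\<lambda>n. s n x) \<longlonglongrightarrow> f x"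
  shows "(\<lambda>n. LINT x:A|M. \<bar>s n x - f x\<bar>) \<longlonglongrightarrow> 0"
proof -
  have "(\<lambda>n. LINT x|M. indicator A x *\<^sub>R \<bar>s n x - f x\<bar>) \<longlonglongrightarrow> (LINT x|M. 0)"
  proof (rule integral_dominated_convergence)
    show "integrable M (\<lambda>x. indicator A x *\<^sub>R w x)"
      using w(1) by (simp add: set_integrable_def)
    show "AE x in M. (\<lambda>n. indicator A x *\<^sub>R \<bar>s n x - f x\<bar>) \<longlonglongrightarrow> 0"
      using lim
    proof eventually_elim
      case (elim x)
      then show ?case
        using tendsto_rabs_zero[OF LIM_zero[of "\<lambda>n. s n x" "f x"]] by (cases "x \<in> A") auto
    qed
    show "AE x in M. norm (indicator A x *\<^sub>R \<bar>s n x - f x\<bar>) \<le> indicator A x *\<^sub>R w x" for n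
      using w(2) by (auto simp: indicator_def)
  qed (use A f s in measurable)
  then show ?thesis by (simp add: set_lebesgue_integral_def)
qed

lemma bounded_approx_continuous_L1:
  fixes f :: "'a::euclidean_space \<Rightarrow> real"
  assumes S: "S \<in> lmeasurable" and f: "f \<in> borel_measurable lebesgue" "\<And>x. \<bar>f x\<bar> \<le> M" and "e > 0"
  obtains g where "continuous_on UNIV g" "\<And>x. \<bar>g x\<bar> \<le> M" "(LINT x:S|lebesgue. \<bar>g x - f x\<bar>) < e"
proof -
  have "f measurable_on UNIV"
    using f(1) by (rule lebesgue_measurable_imp_measurable_on) simp
  then obtain N g where "negligible N" and cont: "\<And>n. continuous_on UNIV (g n)"
    and lim: "\<And>x. x \<notin> N \<Longrightarrow> (\<lambda>n. g n x) \<longlonglongrightarrow> f x"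
    by (auto simp: measurable_on_def)
  define h where "h n x = max (- M) (min M (g n x))" for n x
  have h: "continuous_on UNIV (h n)" "\<bar>h n x\<bar> \<le> M" for n x
    using f(2)[of x] unfolding h_def by (auto intro!: continuous_intros cont)
  have hlim: "(\<lambda>n. h n x) \<longlonglongrightarrow> f x" if "x \<notin> N" for x
  proof -
    have "(\<lambda>n. h n x) \<longlonglongrightarrow> max (- M) (min M (f x))"
      unfolding h_def by (intro tendsto_intros lim that)
    moreover have "max (- M) (min M (f x)) = f x" using f(2)[of x] by auto
    ultimately show ?thesis by simp
  qed
  have "(\<lambda>n. LINT x:S|lebesgue. \<bar>h n x - f x\<bar>) \<longlonglongrightarrow> 0"
  proof (rule set_integral_abs_diff_tendsto_0)
    show "h n \<in> borel_measurable lebesgue" for n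
      by (intro measurable_completion) (simp add: borel_measurable_continuous_onI h)
    show "set_integrable lebesgue S (\<lambda>_. 2 * M)" by (rule absolutely_integrable_on_const[OF S])
    show "\<bar>h n x - f x\<bar> \<le> 2 * M" for n x using h(2)[of n x] f(2)[of x] by linarith
    have "AE x in lebesgue. x \<notin> N"
      using \<open>negligible N\<close> by (intro AE_not_in) (simp add: negligible_iff_null_sets)
    then show "AE x in lebesgue. x \<in> S \<longrightarrow> (\<lambda>n. h n x) \<longlonglongrightarrow> f x"
      by eventually_elim (simp add: hlim)
  qed (use S f in auto)
  then have "\<forall>\<^sub>F n in sequentially. (LINT x:S|lebesgue. \<bar>h n x - f x\<bar>) < e"
    using \<open>e > 0\<close> by (rule order_tendstoD)
  then obtain n where "(LINT x:S|lebesgue. \<bar>h n x - f x\<bar>) < e"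
    using eventually_happens trivial_limit_sequentially by blast
  with h show ?thesis by (intro that[of "h n"])
qed

lemma set_integrable_approx_bounded_L1:
  fixes f :: "'a \<Rightarrow> real"
  assumes S: "S \<in> sets M" and f: "set_integrable M S f" and "e > 0"
  obtains h m where "h \<in> borel_measurable M" "\<And>x. \<bar>h x\<bar> \<le> m" "(LINT x:S|M. \<bar>h x - f x\<bar>) < e"
proof -
  define F where "F x = indicator S x *\<^sub>R f x" for x
  define h where "h n x = max (- real n) (min (real n) (F x))" for n x
  have F: "F \<in> borel_measurable M"
    using f unfolding F_def set_integrable_def by (rule borel_measurable_integrable)
  then have h: "h n \<in> borel_measurable M" "\<bar>h n x\<bar> \<le> real n" for n x
    unfolding h_def by (auto intro!: borel_measurable_max borel_measurable_min)
  have "(\<lambda>n. LINT x:S|M. \<bar>h n x - F x\<bar>) \<longlonglongrightarrow> 0"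
  proof (rule set_integral_abs_diff_tendsto_0)
    show "set_integrable M S (\<lambda>x. \<bar>f x\<bar>)" using f by (rule set_integrable_abs)
    show "\<bar>h n x - F x\<bar> \<le> \<bar>f x\<bar>" if "x \<in> S" for n x using that by (auto simp: h_def F_def)
    show "AE x in M. x \<in> S \<longrightarrow> (\<lambda>n. h n x) \<longlonglongrightarrow> F x"
    proof (intro AE_I2 impI tendsto_eventually)
      fix x
      obtain m where "\<bar>F x\<bar> \<le> real m" using real_arch_simple by blast
      then show "\<forall>\<^sub>F n in sequentially. h n x = F x"
        by (intro eventually_sequentiallyI[of m]) (auto simp: h_def)
    qed
  qed (use S F h in auto)
  then have "\<forall>\<^sub>F n in sequentially. (LINT x:S|M. \<bar>h n x - F x\<bar>) < e"
    using \<open>e > 0\<close> by (rule order_tendstoD)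
  then obtain n where "(LINT x:S|M. \<bar>h n x - F x\<bar>) < e"
    using eventually_happens trivial_limit_sequentially by blast
  moreover have "(LINT x:S|M. \<bar>h n x - F x\<bar>) = (LINT x:S|M. \<bar>h n x - f x\<bar>)"
    using S by (intro set_lebesgue_integral_cong) (auto simp: F_def)
  ultimately show ?thesis using h by (intro that) auto
qed

lemma set_integrable_approx_continuous_L1:
  fixes f :: "'a::euclidean_space \<Rightarrow> real"
  assumes S: "S \<in> lmeasurable" and f: "set_integrable lebesgue S f" and "e > 0"
  obtains g where "continuous_on UNIV g" "set_integrable lebesgue S g"
    "(LINT x:S|lebesgue. \<bar>f x - g x\<bar>) < e"
proof -
  obtain h m where h: "h \<in> borel_measurable lebesgue" "\<And>x. \<bar>h x\<bar> \<le> m"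
    and hf: "(LINT x:S|lebesgue. \<bar>h x - f x\<bar>) < e / 2"
    using set_integrable_approx_bounded_L1[of S lebesgue f "e / 2"] S f \<open>e > 0\<close> by auto
  obtain g where g: "continuous_on UNIV g" "\<And>x. \<bar>g x\<bar> \<le> m"
    and gh: "(LINT x:S|lebesgue. \<bar>g x - h x\<bar>) < e / 2"
    using bounded_approx_continuous_L1[OF S h] \<open>e > 0\<close> by (metis half_gt_zero)
  have integrable: "set_integrable lebesgue S k"
    if "k \<in> borel_measurable lebesgue" "\<And>x. \<bar>k x\<bar> \<le> m" for k
    by (rule set_integrable_bound[OF absolutely_integrable_on_const[OF S, of m]])
       (use that S order_trans[OF that(2) abs_ge_self] in \<open>auto simp: set_borel_measurable_def\<close>)
  have "g \<in> borel_measurable lebesgue"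
    by (intro measurable_completion) (simp add: borel_measurable_continuous_onI g)
  then have int_g: "set_integrable lebesgue S g" using g(2) by (rule integrable)
  have int_diffs: "set_integrable lebesgue S (\<lambda>x. \<bar>h x - f x\<bar>)"
    "set_integrable lebesgue S (\<lambda>x. \<bar>g x - h x\<bar>)"
    using integrable[OF h] int_g f by (auto intro: set_integrable_abs)
  have "(LINT x:S|lebesgue. \<bar>f x - g x\<bar>) \<le> (LINT x:S|lebesgue. \<bar>h x - f x\<bar> + \<bar>g x - h x\<bar>)"
    by (intro set_integral_mono set_integral_add set_integrable_abs set_integral_diff int_diffs int_g f)
       auto
  also have "\<dots> = (LINT x:S|lebesgue. \<bar>h x - f x\<bar>) + (LINT x:S|lebesgue. \<bar>g x - h x\<bar>)"
    by (intro set_integral_add int_diffs)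
  finally show ?thesis using hf gh g int_g by (intro that[of g]) auto
qed

section \<open>Densities\<close>

lemma is_densityD:
  assumes "is_density \<rho>"
  shows "t \<ge> 0 \<Longrightarrow> \<rho> t \<ge> 0" "set_integrable lebesgue {0..} \<rho>" "(LINT t:{0..}|lebesgue. \<rho> t) = 1"
  using assms by (auto simp: is_density_def)

lemma set_integrable_density:
  assumes "is_density \<rho>" "A \<in> sets lebesgue" "A \<subseteq> {0..}"
  shows "set_integrable lebesgue A \<rho>"
  using is_densityD(2)[OF assms(1)] assms(2,3) by (rule set_integrable_subset)

lemma tail_nonneg: "is_density \<rho> \<Longrightarrow> s \<ge> 0 \<Longrightarrow> tail \<rho> s \<ge> 0"
  unfolding tail_def by (rule set_integral_nonneg) (simp add: is_densityD)

lemma tail_antimono: "is_density \<rho> \<Longrightarrow> 0 \<le> s \<Longrightarrow> s \<le> t \<Longrightarrow> tail \<rho> t \<le> tail \<rho> s"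
  unfolding tail_def
  by (rule set_integral_mono_set) (auto intro!: set_integrable_density simp: is_densityD)

lemma tail_0: "is_density \<rho> \<Longrightarrow> tail \<rho> 0 = 1"
  by (simp add: tail_def is_densityD)

lemma tail_le_1: "is_density \<rho> \<Longrightarrow> s \<ge> 0 \<Longrightarrow> tail \<rho> s \<le> 1"
  using tail_antimono[of \<rho> 0 s] tail_0 by simp

lemma tail_cong: "(\<And>t. t \<ge> 0 \<Longrightarrow> \<rho> t = \<rho>' t) \<Longrightarrow> s \<ge> 0 \<Longrightarrow> tail \<rho> s = tail \<rho>' s"
  unfolding tail_def by (rule set_lebesgue_integral_cong) auto

lemma set_integral_density_Icc:
  assumes "is_density \<rho>" "s \<ge> 0"
  shows "(LINT t:{0..s}|lebesgue. \<rho> t) = 1 - tail \<rho> s"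
proof -
  have "{0..} \<inter> {..s} = {0..s}" "{0..} \<inter> {s..} = {s..}" using assms(2) by auto
  then show ?thesis
    using set_integral_split_at[OF is_densityD(2)[OF assms(1)], of s] is_densityD(3)[OF assms(1)]
    by (simp add: tail_def)
qed

lemma tail_tendsto_0:
  assumes "is_density \<rho>"
  shows "(tail \<rho> \<longlongrightarrow> 0) at_top"
proof -
  have "((\<lambda>s. LINT t:{0..s}|lebesgue. \<rho> t) \<longlongrightarrow> (LINT t:{0..}|lebesgue. \<rho> t)) at_top"
    using assms by (intro tendsto_set_lebesgue_integral_at_top) (auto simp: is_densityD)
  then have "((\<lambda>s. 1 - (LINT t:{0..s}|lebesgue. \<rho> t)) \<longlongrightarrow> 1 - 1) at_top"
    using assms by (intro tendsto_intros) (simp add: is_densityD)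
  moreover have "\<forall>\<^sub>F s in at_top. 1 - (LINT t:{0..s}|lebesgue. \<rho> t) = tail \<rho> s"
    using eventually_ge_at_top[of 0] by eventually_elim (simp add: set_integral_density_Icc assms)
  ultimately show ?thesis by (simp add: tendsto_cong)
qed

lemma continuous_on_tail:
  assumes "is_density \<rho>"
  shows "continuous_on {0..b} (tail \<rho>)"
proof -
  have integral_eq: "integral {0..s} \<rho> = (LINT t:{0..s}|lebesgue. \<rho> t)" "\<rho> integrable_on {0..s}" for s
    using set_lebesgue_integral_eq_integral[of "{0..s}" \<rho>] set_integrable_density[OF assms, of "{0..s}"]
    by auto
  have "continuous_on {0..b} (\<lambda>s. 1 - integral {0..s} \<rho>)"
    by (intro continuous_intros indefinite_integral_continuous_1 integral_eq)
  then show ?thesis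
    by (rule continuous_on_eq) (simp add: integral_eq set_integral_density_Icc assms)
qed

lemma ex_tail_eq:
  assumes "is_density \<rho>" "0 < x" "x < 1"
  shows "\<exists>s>0. tail \<rho> s = x"
proof -
  have "\<forall>\<^sub>F b in at_top. tail \<rho> b < x \<and> b \<ge> 0"
    using tail_tendsto_0[OF assms(1)] \<open>0 < x\<close>
    by (intro eventually_conj order_tendstoD eventually_ge_at_top)
  then obtain b where "tail \<rho> b < x" "b \<ge> 0"
    using eventually_happens trivial_limit_at_top_linorder by blast
  then obtain s where "s \<ge> 0" "tail \<rho> s = x"
    using IVT2'[of "tail \<rho>" b x 0] continuous_on_tail[OF assms(1)] assms by (auto simp: tail_0)
  moreover have "s \<noteq> 0" using assms \<open>tail \<rho> s = x\<close> by (auto simp: tail_0)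
  ultimately show ?thesis by (intro exI[of _ s]) simp
qed

lemma
  fixes F f :: "real \<Rightarrow> real"
  assumes F: "\<And>t. t \<ge> a \<Longrightarrow> (F has_real_derivative - f t) (at t)" "(F \<longlongrightarrow> 0) at_top"
    and f: "\<And>t. t \<ge> a \<Longrightarrow> f t \<ge> 0" "f \<in> borel_measurable borel"
  shows set_integrable_of_antiderivative: "set_integrable lebesgue {a..} f"
    and tail_eq_antiderivative: "tail f a = F a"
proof -
  have antimono: "F t \<le> F a" if "t \<ge> a" for t
  proof (rule DERIV_nonpos_imp_nonincreasing[OF that])
    show "\<exists>y. DERIV F u :> y \<and> y \<le> 0" if "a \<le> u" for u using F(1)[OF that] f(1)[OF that] by force
  qed
  have "F a \<ge> 0"
    by (rule tendsto_upperbound[OF F(2)])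
       (auto intro: eventually_mono[OF eventually_ge_at_top[of a]] antimono)
  have "(\<integral>\<^sup>+t. ennreal (f t) * indicator {a..} t \<partial>lborel) = ennreal (0 - - F a)"
  proof (rule nn_integral_FTC_atLeast)
    show "((\<lambda>t. - F t) has_real_derivative f t) (at t)" if "a \<le> t" for t
      using DERIV_minus[OF F(1)[OF that]] by simp
    show "((\<lambda>t. - F t) \<longlongrightarrow> 0) at_top" using tendsto_minus[OF F(2)] by simp
  qed (use f in auto)
  moreover have "ennreal (f t) * indicator {a..} t = ennreal (indicator {a..} t *\<^sub>R f t)" for t
    by (simp add: indicator_def)
  ultimately have "(\<integral>\<^sup>+t. ennreal (indicator {a..} t *\<^sub>R f t) \<partial>lborel) = ennreal (F a)"
    by simp
  then have "has_bochner_integral lborel (\<lambda>t. indicator {a..} t *\<^sub>R f t) (F a)"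
    using f \<open>F a \<ge> 0\<close> by (intro has_bochner_integral_nn_integral) (auto simp: indicator_def)
  then have "has_bochner_integral lebesgue (\<lambda>t. indicator {a..} t *\<^sub>R f t) (F a)"
    using f(2) by (simp add: has_bochner_integral_iff integrable_completion integral_completion)
  then show "set_integrable lebesgue {a..} f" "tail f a = F a"
    by (auto simp: has_bochner_integral_iff set_integrable_def set_lebesgue_integral_def tail_def)
qed

lemma is_density_of_antiderivative:
  assumes "\<And>t. t \<ge> 0 \<Longrightarrow> (F has_real_derivative - f t) (at t)" "(F \<longlongrightarrow> 0) at_top" "F 0 = 1"
    and "\<And>t. t \<ge> 0 \<Longrightarrow> f t \<ge> 0" "f \<in> borel_measurable borel"
  shows "is_density f"
  using set_integrable_of_antiderivative[of 0 F f] tail_eq_antiderivative[of 0 F f] assms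
  by (simp add: is_density_def tail_def)

subsection \<open>Rescaling and shifting\<close>

lemma is_density_scale:
  assumes "is_density \<rho>" "l > 0"
  shows "is_density (scale \<rho> l)"
  unfolding is_density_def scale_def
proof (intro conjI)
  have mem_iff: "t \<in> {0..} \<longleftrightarrow> 0 + l * t \<in> {0..}" for t
    using assms(2) by (simp add: zero_le_mult_iff)
  show "set_integrable lebesgue {0..} (\<lambda>t. l * \<rho> (l * t))"
    using set_integrable_affine[OF assms(2) mem_iff is_densityD(2)[OF assms(1)]] by simp
  show "(LINT t:{0..}|lebesgue. l * \<rho> (l * t)) = 1"
    using set_integral_affine[OF assms(2) mem_iff, of \<rho>] is_densityD(3)[OF assms(1)] by simp
qed (use assms in \<open>auto simp: is_densityD\<close>)

lemma tail_scale:
  assumes "l > 0"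
  shows "tail (scale \<rho> l) T = tail \<rho> (l * T)"
  using set_integral_affine[of l "{T..}" 0 "{l * T..}" \<rho>] assms by (simp add: tail_def scale_def)

lemma is_density_shift:
  assumes "is_density \<rho>" "T \<ge> 0" "tail \<rho> T > 0"
  shows "is_density (shift \<rho> T)"
  unfolding is_density_def shift_def
proof (intro conjI)
  have "set_integrable lebesgue {0..} (\<lambda>t. \<rho> (t + T))"
    using set_integrable_affine[of 1 "{0..}" T "{T..}" \<rho>]
      set_integrable_density[OF assms(1), of "{T..}"] assms(2) by (simp add: add.commute)
  then show "set_integrable lebesgue {0..} (\<lambda>t. \<rho> (t + T) / tail \<rho> T)" by simp
  have "(LINT t:{0..}|lebesgue. \<rho> (t + T)) = tail \<rho> T"
    using set_integral_affine[of 1 "{0..}" T "{T..}" \<rho>] by (simp add: tail_def add.commute)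
  then show "(LINT t:{0..}|lebesgue. \<rho> (t + T) / tail \<rho> T) = 1" using assms(3) by simp
qed (use assms in \<open>auto simp: is_densityD\<close>)

lemma tail_shift: "tail (shift \<rho> s) t = tail \<rho> (s + t) / tail \<rho> s"
proof -
  have "(LINT x:{t..}|lebesgue. \<rho> (x + s)) = tail \<rho> (s + t)"
    using set_integral_affine[of 1 "{t..}" s "{s + t..}" \<rho>] by (simp add: tail_def add.commute)
  moreover have "tail (shift \<rho> s) t = (LINT x:{t..}|lebesgue. \<rho> (x + s)) / tail \<rho> s"
    unfolding shift_def tail_def[of _ t] by (rule set_integral_divide_zero)
  ultimately show ?thesis by simp
qed

lemma shift_scale:
  assumes "l > 0"
  shows "shift (scale \<rho> l) T = scale (shift \<rho> (l * T)) l"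
  using assms by (simp add: shift_def tail_scale) (simp add: scale_def algebra_simps)

lemma scale_scale: "scale (scale \<rho> r) l = scale \<rho> (r * l)"
  by (simp add: scale_def algebra_simps)

lemma shift_cong:
  assumes "\<And>t. t \<ge> 0 \<Longrightarrow> \<rho> t = \<rho>' t" "T \<ge> 0" "t \<ge> 0"
  shows "shift \<rho> T t = shift \<rho>' T t"
  using assms tail_cong[of \<rho> \<rho>' T] by (simp add: shift_def)

subsection \<open>Mean absolute deviation on an interval\<close>

definition mean_deviation :: "(real \<Rightarrow> real) \<Rightarrow> real \<Rightarrow> real \<Rightarrow> real" where
  "mean_deviation f a b = (LINT t:{a..b}|lebesgue. \<bar>f t - (LINT x:{a..b}|lebesgue. f x) / (b - a)\<bar>)"

lemma mean_deviation_nonneg: "mean_deviation f a b \<ge> 0"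
  unfolding mean_deviation_def by (rule set_integral_nonneg) simp

lemma mean_deviation_affine:
  assumes "c > 0"
  shows "mean_deviation (\<lambda>t. c * f (s + c * t)) a b = mean_deviation f (s + c * a) (s + c * b)"
proof -
  have mem_iff: "t \<in> {a..b} \<longleftrightarrow> s + c * t \<in> {s + c * a..s + c * b}" for t using assms by simp
  define m where "m = (LINT x:{s + c * a..s + c * b}|lebesgue. f x) / (s + c * b - (s + c * a))"
  have "(LINT x:{a..b}|lebesgue. c * f (s + c * x)) / (b - a) = c * m"
    using set_integral_affine[OF assms mem_iff, of f] assms
    by (simp add: m_def flip: right_diff_distrib)
  moreover have "\<bar>c * f (s + c * t) - c * m\<bar> = c * \<bar>f (s + c * t) - m\<bar>" for t
    using assms by (simp add: abs_mult flip: right_diff_distrib)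
  ultimately have "mean_deviation (\<lambda>t. c * f (s + c * t)) a b
      = c * (LINT t:{a..b}|lebesgue. \<bar>f (s + c * t) - m\<bar>)"
    by (simp add: mean_deviation_def)
  also have "\<dots> = mean_deviation f (s + c * a) (s + c * b)"
    using set_integral_affine[OF assms mem_iff, of "\<lambda>t. \<bar>f t - m\<bar>"]
    by (simp add: mean_deviation_def m_def)
  finally show ?thesis .
qed

lemma mean_deviation_divide:
  "mean_deviation (\<lambda>t. f t / k) a b = mean_deviation f a b / \<bar>k\<bar>"
proof -
  have "\<bar>f t / k - m / k / (b - a)\<bar> = \<bar>f t - m / (b - a)\<bar> / \<bar>k\<bar>" for t m
    by (simp add: diff_divide_distrib mult.commute flip: abs_divide)
  then show ?thesis by (simp add: mean_deviation_def)
qed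

lemma mean_deviation_scale: "l > 0 \<Longrightarrow> mean_deviation (scale \<rho> l) a b = mean_deviation \<rho> (l * a) (l * b)"
  using mean_deviation_affine[of l \<rho> 0 a b] by (simp add: scale_def)

lemma mean_deviation_shift:
  "mean_deviation (shift \<rho> s) a b = mean_deviation \<rho> (s + a) (s + b) / \<bar>tail \<rho> s\<bar>"
  using mean_deviation_affine[of 1 \<rho> s a b]
  by (simp add: shift_def mean_deviation_divide add.commute)

lemma mean_deviation_const:
  assumes "a < b" "\<And>t. t \<in> {a..b} \<Longrightarrow> f t = c"
  shows "mean_deviation f a b = 0"
proof -
  have "(LINT x:{a..b}|lebesgue. f x) = (LINT x:{a..b}|lebesgue. c)"
    using assms by (intro set_lebesgue_integral_cong) auto
  also have "\<dots> = c * (b - a)" using assms(1) by (simp add: set_lebesgue_integral_def)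
  finally have "mean_deviation f a b = (LINT t:{a..b}|lebesgue. 0)"
    unfolding mean_deviation_def using assms by (intro set_lebesgue_integral_cong) auto
  then show ?thesis by simp
qed

lemma mean_deviation_le_L1_dist_const:
  assumes "set_integrable lebesgue {a..b} f" "a < b"
  shows "mean_deviation f a b \<le> 2 * (LINT t:{a..b}|lebesgue. \<bar>f t - c\<bar>)"
proof -
  define m where "m = (LINT x:{a..b}|lebesgue. f x) / (b - a)"
  have const: "set_integrable lebesgue {a..b} (\<lambda>_. k)" "(LINT t:{a..b}|lebesgue. k) = k * (b - a)"
    for k :: real
    using assms(2) by (auto intro!: absolutely_integrable_on_const simp: set_lebesgue_integral_def)
  note integrable = assms(1) const(1) set_integrable_abs set_integral_diff set_integral_add
  have diff: "set_integrable lebesgue {a..b} (\<lambda>t. c - f t)" by (intro integrable)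
  have "(c - m) * (b - a) = (LINT t:{a..b}|lebesgue. c - f t)"
    using assms const(2)[of c] set_integral_diff(2)[OF const(1) assms(1), of c]
    by (simp add: m_def left_diff_distrib)
  then have "\<bar>c - m\<bar> * (b - a) = norm (LINT t:{a..b}|lebesgue. c - f t)"
    using assms(2) by (simp add: abs_mult flip: \<open>(c - m) * (b - a) = _\<close>)
  also have "\<dots> \<le> (LINT t:{a..b}|lebesgue. \<bar>c - f t\<bar>)"
    using set_integral_norm_bound[OF diff] by simp
  finally have mean: "(LINT t:{a..b}|lebesgue. \<bar>c - m\<bar>) \<le> (LINT t:{a..b}|lebesgue. \<bar>f t - c\<bar>)"
    by (simp only: const(2) abs_minus_commute)
  have "mean_deviation f a b \<le> (LINT t:{a..b}|lebesgue. \<bar>f t - c\<bar> + \<bar>c - m\<bar>)"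
    unfolding mean_deviation_def m_def[symmetric] by (intro set_integral_mono integrable) auto
  also have "\<dots> = (LINT t:{a..b}|lebesgue. \<bar>f t - c\<bar>) + (LINT t:{a..b}|lebesgue. \<bar>c - m\<bar>)"
    by (intro integrable)
  finally show ?thesis using mean by simp
qed

section \<open>Self-similar densities\<close>

definition self_similar :: "(real \<Rightarrow> real) \<Rightarrow> bool" where
  "self_similar \<mu> \<longleftrightarrow> is_density \<mu> \<and>
     (\<forall>s\<ge>0. tail \<mu> s > 0 \<longrightarrow> (\<exists>r>0. \<forall>t\<ge>0. shift \<mu> s t = scale \<mu> r t))"

definition tauberian_density :: "(real \<Rightarrow> real) \<Rightarrow> bool" where
  "tauberian_density \<mu> \<longleftrightarrow> self_similar \<mu> \<and>
     (\<exists>C. \<forall>s>0. tail \<mu> s > 0 \<longrightarrow> mean_deviation \<mu> 0 s \<le> C * (1 - tail \<mu> s)\<^sup>2)"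

lemma tauberian_density_is_density: "tauberian_density \<mu> \<Longrightarrow> is_density \<mu>"
  by (simp add: tauberian_density_def self_similar_def)

lemma mean_deviation_le_antimono:
  assumes integrable_f: "set_integrable lebesgue {a..b} f" and "a < b"
    and anti: "antimono_on {a..b} f" and pos: "f a > 0" "f b \<ge> 0"
  shows "mean_deviation f a b \<le> 2 * (1 - f b / f a) * (LINT t:{a..b}|lebesgue. f t)"
proof -
  define m where "m = (LINT x:{a..b}|lebesgue. f x) / (b - a)"
  define q where "q = f b / f a"
  have const: "set_integrable lebesgue {a..b} (\<lambda>_. k)" "(LINT t:{a..b}|lebesgue. k) = k * (b - a)"
    for k :: real
    using assms(2) by (auto intro!: absolutely_integrable_on_const simp: set_lebesgue_integral_def)
  note integrable = integrable_f const(1) set_integrable_abs set_integral_diff set_integral_add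
  have f_between: "f b \<le> f t" "f t \<le> f a" if "t \<in> {a..b}" for t
    using that \<open>a < b\<close> monotone_onD[OF anti, of a t] monotone_onD[OF anti, of t b] by auto
  have "f b * (b - a) \<le> m * (b - a)" "m * (b - a) \<le> f a * (b - a)"
    using set_integral_mono[OF const(1) integrable_f, of "f b"]
      set_integral_mono[OF integrable_f const(1), of "f a"] f_between \<open>a < b\<close>
    by (auto simp: m_def const(2))
  then have m: "f b \<le> m" "m \<le> f a" using \<open>a < b\<close> by auto
  have q: "0 \<le> q" "q \<le> 1" using pos f_between(2)[of b] \<open>a < b\<close> by (auto simp: q_def)
  have q_le: "x * q \<le> f b" if "x \<le> f a" for x
    using mult_right_mono[OF that q(1)] pos by (simp add: q_def)
  have "\<bar>f t - m\<bar> \<le> (f t + m) * (1 - q)" if t: "t \<in> {a..b}" for t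
  proof -
    have "0 \<le> f t * (1 - q)" "0 \<le> m * (1 - q)" using q f_between(1)[OF t] m pos by auto
    then show ?thesis
      using q_le[OF f_between(2)[OF t]] q_le[OF m(2)] f_between(1)[OF t] m(1)
      by (simp add: algebra_simps)
  qed
  then have "mean_deviation f a b \<le> (LINT t:{a..b}|lebesgue. (f t + m) * (1 - q))"
    unfolding mean_deviation_def m_def[symmetric]
    by (intro set_integral_mono set_integrable_mult_left integrable) auto
  also have "\<dots> = ((LINT t:{a..b}|lebesgue. f t) + m * (b - a)) * (1 - q)"
    using integrable by (simp add: const(2))
  also have "\<dots> = 2 * (1 - q) * (LINT t:{a..b}|lebesgue. f t)"
    using \<open>a < b\<close> by (simp add: m_def)
  finally show ?thesis by (simp add: q_def)
qed

lemma tauberian_densityI: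
  assumes sim: "self_similar \<mu>" and anti: "antimono_on {0..} \<mu>" and pos: "\<mu> 0 > 0"
    and drop: "\<And>s. s > 0 \<Longrightarrow> 1 - \<mu> s / \<mu> 0 \<le> L * (1 - tail \<mu> s)"
  shows "tauberian_density \<mu>"
  unfolding tauberian_density_def
proof (intro conjI exI allI impI sim)
  fix s :: real
  assume "s > 0"
  have \<mu>: "is_density \<mu>" using sim by (simp add: self_similar_def)
  have head: "0 \<le> 1 - tail \<mu> s" using tail_le_1[OF \<mu>, of s] \<open>s > 0\<close> by simp
  have "mean_deviation \<mu> 0 s \<le> 2 * (1 - \<mu> s / \<mu> 0) * (LINT t:{0..s}|lebesgue. \<mu> t)"
    using \<open>s > 0\<close> is_densityD(1)[OF \<mu>] pos
    by (intro mean_deviation_le_antimono set_integrable_density[OF \<mu>] monotone_on_subset[OF anti]) auto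
  also have "\<dots> = 2 * (1 - \<mu> s / \<mu> 0) * (1 - tail \<mu> s)"
    using \<open>s > 0\<close> by (simp add: set_integral_density_Icc[OF \<mu>])
  also have "\<dots> \<le> 2 * (L * (1 - tail \<mu> s)) * (1 - tail \<mu> s)"
    using drop[OF \<open>s > 0\<close>] head by (intro mult_right_mono mult_left_mono) auto
  finally show "mean_deviation \<mu> 0 s \<le> 2 * L * (1 - tail \<mu> s)\<^sup>2"
    by (simp add: power2_eq_square mult.assoc)
qed

subsection \<open>Uniform densities\<close>

lemma unif_avg_eq_scale: "T > 0 \<Longrightarrow> unif_avg T = scale (unif_avg 1) (1 / T)"
  by (auto simp: scale_def unif_avg_def indicator_def fun_eq_iff field_simps)

lemma tail_unif_avg_1:
  assumes "s \<ge> 0"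
  shows "tail (unif_avg 1) s = max 0 (1 - s)"
proof -
  have "(\<lambda>x. indicator {s..} x *\<^sub>R unif_avg 1 x) = indicat_real {s..1}"
    using assms by (auto simp: fun_eq_iff indicator_def unif_avg_def)
  then show ?thesis by (simp add: tail_def set_lebesgue_integral_def)
qed

lemma is_density_unif_avg_1: "is_density (unif_avg 1)"
proof -
  have "(\<lambda>x. indicator {0..} x *\<^sub>R unif_avg 1 x) = (\<lambda>x. indicator {0..1::real} x *\<^sub>R 1)"
    by (auto simp: fun_eq_iff indicator_def unif_avg_def)
  moreover have "set_integrable lebesgue {0..1::real} (\<lambda>_. 1::real)"
    by (rule absolutely_integrable_on_const) auto
  ultimately show ?thesis
    using tail_unif_avg_1[of 0] by (simp add: is_density_def set_integrable_def tail_def unif_avg_def)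
qed

lemma is_density_unif_avg: "T > 0 \<Longrightarrow> is_density (unif_avg T)"
  using is_density_scale[OF is_density_unif_avg_1, of "1 / T"] unif_avg_eq_scale[of T] by simp

lemma self_similar_unif_avg_1: "self_similar (unif_avg 1)"
  unfolding self_similar_def
proof (intro conjI is_density_unif_avg_1 allI impI)
  fix s :: real
  assume "s \<ge> 0" "tail (unif_avg 1) s > 0"
  then have "s < 1" by (simp add: tail_unif_avg_1)
  have "shift (unif_avg 1) s t = scale (unif_avg 1) (1 / (1 - s)) t" if "t \<ge> 0" for t
  proof -
    have "t + s \<in> {0..1} \<longleftrightarrow> 1 / (1 - s) * t \<in> {0..1}"
      using \<open>s \<ge> 0\<close> \<open>s < 1\<close> that by (auto simp: pos_divide_le_eq)
    moreover have "tail (unif_avg 1) s = 1 - s" using \<open>s \<ge> 0\<close> \<open>s < 1\<close> by (simp add: tail_unif_avg_1)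
    ultimately show ?thesis
      unfolding shift_def scale_def by (simp add: unif_avg_def indicator_def)
  qed
  with \<open>s < 1\<close> show "\<exists>r>0. \<forall>t\<ge>0. shift (unif_avg 1) s t = scale (unif_avg 1) r t"
    by (intro exI[of _ "1 / (1 - s)"]) simp
qed

lemma mean_deviation_unif_avg_1: "0 \<le> a \<Longrightarrow> a < b \<Longrightarrow> b \<le> 1 \<Longrightarrow> mean_deviation (unif_avg 1) a b = 0"
  by (rule mean_deviation_const[where c = 1]) (auto simp: unif_avg_def)

lemma tauberian_unif_avg_1: "tauberian_density (unif_avg 1)"
  unfolding tauberian_density_def
proof (intro conjI self_similar_unif_avg_1 exI[of _ 0] allI impI)
  fix s :: real
  assume "s > 0" "tail (unif_avg 1) s > 0"
  then show "mean_deviation (unif_avg 1) 0 s \<le> 0 * (1 - tail (unif_avg 1) s)\<^sup>2"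
    by (simp add: tail_unif_avg_1 mean_deviation_unif_avg_1)
qed

subsection \<open>Exponential densities\<close>

lemma expd_eq_scale: "expd l = scale (expd 1) l"
  by (simp add: expd_def scale_def)

lemma is_density_expd: "is_density (expd 1)"
  and tail_expd: "s \<ge> 0 \<Longrightarrow> tail (expd 1) s = exp (- s)"
proof -
  have deriv: "((\<lambda>t. exp (- t)) has_real_derivative - expd 1 t) (at t)" for t
    by (auto intro!: derivative_eq_intros simp: expd_def)
  have lim: "((\<lambda>t::real. exp (- t)) \<longlongrightarrow> 0) at_top"
    by (rule filterlim_compose[OF exp_at_bot filterlim_uminus_at_bot_at_top])
  have meas: "expd 1 \<in> borel_measurable borel" unfolding expd_def by measurable
  show "is_density (expd 1)"
    by (rule is_density_of_antiderivative[OF deriv lim _ _ meas]) (auto simp: expd_def)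
  show "s \<ge> 0 \<Longrightarrow> tail (expd 1) s = exp (- s)"
    by (rule tail_eq_antiderivative[OF deriv lim _ meas]) (auto simp: expd_def)
qed

lemma tauberian_expd: "tauberian_density (expd 1)"
proof (rule tauberian_densityI[where L = 1])
  have "shift (expd 1) s t = scale (expd 1) 1 t" if "s \<ge> 0" for s t
    unfolding shift_def tail_expd[OF that]
    by (simp add: expd_def scale_def exp_add exp_minus field_simps)
  then show "self_similar (expd 1)"
    unfolding self_similar_def using is_density_expd zero_less_one by blast
  show "antimono_on {0..} (expd 1)" by (auto intro!: monotone_onI simp: expd_def)
qed (auto simp: tail_expd, auto simp: expd_def)

lemma pw_continuous_pos_expd: "pw_continuous_pos (expd 1)"
proof -
  have cont: "isCont (expd 1) x" for x unfolding expd_def by (intro continuous_intros)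
  then have "\<forall>x\<in>{a..b} - {}. isCont (expd 1) x" for a b by blast
  moreover have "(expd 1 \<longlongrightarrow> expd 1 x) (at_left x)" "(expd 1 \<longlongrightarrow> expd 1 x) (at_right x)" for x
    using cont[of x] by (auto simp: isCont_def filterlim_at_split)
  ultimately show ?thesis unfolding pw_continuous_pos_def using finite.emptyI by blast
qed

subsection \<open>Power densities\<close>

definition pareto :: "real \<Rightarrow> real \<Rightarrow> real \<Rightarrow> real" where
  "pareto a \<gamma> t = a * (\<gamma> - 1) * (1 + a * t) powr (- \<gamma>)"

lemma
  assumes a: "a > 0" and \<gamma>: "\<gamma> > 1"
  shows is_density_pareto: "is_density (pareto a \<gamma>)"
    and tail_pareto: "s \<ge> 0 \<Longrightarrow> tail (pareto a \<gamma>) s = (1 + a * s) powr (1 - \<gamma>)"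
proof -
  have deriv: "((\<lambda>t. (1 + a * t) powr (1 - \<gamma>)) has_real_derivative - pareto a \<gamma> t) (at t)"
    if "t \<ge> 0" for t
  proof -
    have "1 + a * t > 0" using a that by (simp add: add_pos_nonneg)
    then show ?thesis by (auto intro!: derivative_eq_intros simp: pareto_def algebra_simps)
  qed
  have "filterlim (\<lambda>t. 1 + a * t) at_top at_top"
    by (intro filterlim_tendsto_add_at_top[OF tendsto_const]
        filterlim_tendsto_pos_mult_at_top[OF tendsto_const a] filterlim_ident)
  then have lim: "((\<lambda>t. (1 + a * t) powr (1 - \<gamma>)) \<longlongrightarrow> 0) at_top"
    using \<gamma> by (intro tendsto_neg_powr) auto
  have meas: "pareto a \<gamma> \<in> borel_measurable borel"
    unfolding pareto_def[abs_def] by measurable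
  show "is_density (pareto a \<gamma>)"
    by (rule is_density_of_antiderivative[OF deriv lim _ _ meas]) (use a \<gamma> in \<open>auto simp: pareto_def\<close>)
  show "s \<ge> 0 \<Longrightarrow> tail (pareto a \<gamma>) s = (1 + a * s) powr (1 - \<gamma>)"
    by (rule tail_eq_antiderivative[OF deriv lim _ meas]) (use a \<gamma> in \<open>auto simp: pareto_def\<close>)
qed

lemma shift_pareto:
  assumes "a > 0" "\<gamma> > 1" "s \<ge> 0" "t \<ge> 0"
  shows "shift (pareto a \<gamma>) s t = scale (pareto a \<gamma>) (1 / (1 + a * s)) t"
proof -
  define c where "c = 1 + a * s"
  have c: "c > 0" using assms by (simp add: c_def add_pos_nonneg)
  have "1 + a * (t + s) = c * (1 + a * (t / c))" using c by (simp add: c_def field_simps)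
  then have "(1 + a * (t + s)) powr (- \<gamma>) = c powr (- \<gamma>) * (1 + a * (t / c)) powr (- \<gamma>)"
    using assms c by (simp add: powr_mult)
  moreover have "c powr (1 - \<gamma>) = c * c powr (- \<gamma>)"
    using c by (simp add: powr_diff powr_minus field_simps)
  moreover have "c powr (- \<gamma>) \<noteq> 0" using c by simp
  ultimately show ?thesis
    using assms by (simp add: shift_def scale_def tail_pareto pareto_def flip: c_def)
qed

lemma one_minus_powr_le:
  fixes x \<gamma> :: real
  assumes "x > 0" "\<gamma> > 1"
  shows "1 - x powr (- \<gamma>) \<le> \<gamma> / (\<gamma> - 1) * (1 - x powr (1 - \<gamma>))"
proof -
  have "(x powr (- \<gamma>)) powr ((\<gamma> - 1) / \<gamma>) * 1 powr (1 / \<gamma>) \<le> (\<gamma> - 1) / \<gamma> * x powr (- \<gamma>) + 1 / \<gamma> * 1"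
    using assms by (intro Youngs_inequality_0) (auto simp: field_simps)
  moreover have "- \<gamma> * ((\<gamma> - 1) / \<gamma>) = 1 - \<gamma>" using assms by (simp add: field_simps)
  ultimately have "x powr (1 - \<gamma>) \<le> (\<gamma> - 1) / \<gamma> * x powr (- \<gamma>) + 1 / \<gamma>"
    by (simp add: powr_powr)
  then show ?thesis using assms by (simp add: field_simps)
qed

lemma tauberian_pareto:
  assumes a: "a > 0" and \<gamma>: "\<gamma> > 1"
  shows "tauberian_density (pareto a \<gamma>)"
proof (rule tauberian_densityI)
  have "1 / (1 + a * s) > 0" if "s \<ge> 0" for s using a that by (simp add: add_pos_nonneg)
  then show "self_similar (pareto a \<gamma>)"
    unfolding self_similar_def using is_density_pareto[OF assms] shift_pareto[OF assms] by blast
  show "antimono_on {0..} (pareto a \<gamma>)"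
    unfolding pareto_def using assms
    by (intro monotone_onI mult_left_mono powr_mono2') (auto simp: add_pos_nonneg)
  show "pareto a \<gamma> 0 > 0" using assms by (simp add: pareto_def)
  fix s :: real
  assume "s > 0"
  then have "1 + a * s > 0" using a by (simp add: add_pos_pos)
  then show "1 - pareto a \<gamma> s / pareto a \<gamma> 0 \<le> \<gamma> / (\<gamma> - 1) * (1 - tail (pareto a \<gamma>) s)"
    using one_minus_powr_le[OF _ \<gamma>, of "1 + a * s"] assms \<open>s > 0\<close> by (simp add: tail_pareto pareto_def)
qed

lemma power_density_exponent_gt_1:
  assumes density: "is_density \<rho>" and pos: "\<alpha> > 0" "\<beta> > 0" "\<gamma> > 0"
    and \<rho>: "\<And>t. t \<ge> 0 \<Longrightarrow> \<rho> t = (\<alpha> + \<beta> * t) powr (- \<gamma>)"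
  shows "\<gamma> > 1"
proof (rule ccontr)
  assume "\<not> \<gamma> > 1"
  define b where "b = 1 / (1 + \<alpha> + 2 * \<beta>)"
  have "b > 0" using pos by (simp add: b_def)
  have "b \<le> tail \<rho> T" if "T \<ge> 1" for T
  proof -
    have "b / T \<le> \<rho> t" if t: "t \<in> {T..2 * T}" for t
    proof -
      have base_pos: "0 < 1 + (\<alpha> + \<beta> * t)" using t \<open>T \<ge> 1\<close> pos by (simp add: add_pos_nonneg)
      have "\<beta> * t \<le> \<beta> * (2 * T)" "1 + \<alpha> \<le> (1 + \<alpha>) * T"
        using t \<open>T \<ge> 1\<close> pos by (auto simp: mult_le_cancel_left1)
      then have "1 + (\<alpha> + \<beta> * t) \<le> (1 + \<alpha> + 2 * \<beta>) * T" by (simp add: algebra_simps)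
      then have "b / T \<le> 1 / (1 + (\<alpha> + \<beta> * t))"
        using base_pos by (simp add: b_def frac_le)
      also have "\<dots> = (1 + (\<alpha> + \<beta> * t)) powr (- 1)" using base_pos by (simp add: powr_minus_divide)
      also have "\<dots> \<le> (1 + (\<alpha> + \<beta> * t)) powr (- \<gamma>)"
        using \<open>\<not> \<gamma> > 1\<close> t \<open>T \<ge> 1\<close> pos by (intro powr_mono) auto
      also have "\<dots> \<le> (\<alpha> + \<beta> * t) powr (- \<gamma>)"
        using t \<open>T \<ge> 1\<close> pos by (intro powr_mono2') (auto simp: add_pos_nonneg)
      also have "\<dots> = \<rho> t" using \<rho>[of t] t \<open>T \<ge> 1\<close> by simp
      finally show ?thesis .
    qed
    then have "(LINT t:{T..2 * T}|lebesgue. b / T) \<le> (LINT t:{T..2 * T}|lebesgue. \<rho> t)"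
      using \<open>T \<ge> 1\<close>
      by (intro set_integral_mono absolutely_integrable_on_const set_integrable_density[OF density]) auto
    also have "\<dots> \<le> tail \<rho> T"
      unfolding tail_def using \<open>T \<ge> 1\<close> is_densityD(1)[OF density]
      by (intro set_integral_mono_set set_integrable_density[OF density]) auto
    finally show ?thesis using \<open>T \<ge> 1\<close> by (simp add: set_lebesgue_integral_def)
  qed
  then have "\<forall>\<^sub>F T in at_top. b \<le> tail \<rho> T"
    by (rule eventually_mono[OF eventually_ge_at_top[of 1]])
  then have "b \<le> 0" using tail_tendsto_0[OF density] by (intro tendsto_lowerbound) auto
  with \<open>b > 0\<close> show False by simp
qed

lemma power_density_eq_pareto:
  assumes "power_density \<rho>"
  obtains a \<gamma> where "a > 0" "\<gamma> > 1" "\<And>t. t \<ge> 0 \<Longrightarrow> \<rho> t = pareto a \<gamma> t"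
proof -
  obtain \<alpha> \<beta> \<gamma> where pos: "\<alpha> > 0" "\<beta> > 0" "\<gamma> > 0" and density: "is_density \<rho>"
    and \<rho>: "\<And>t. t \<ge> 0 \<Longrightarrow> \<rho> t = (\<alpha> + \<beta> * t) powr (- \<gamma>)"
    using assms by (auto simp: power_density_def)
  have \<gamma>: "\<gamma> > 1" using power_density_exponent_gt_1[OF density pos \<rho>] .
  define a where "a = \<beta> / \<alpha>"
  define k where "k = \<alpha> powr (- \<gamma>) / (a * (\<gamma> - 1))"
  have a: "a > 0" using pos by (simp add: a_def)
  have proportional: "\<rho> t = k * pareto a \<gamma> t" if "t \<ge> 0" for t
  proof -
    have "\<alpha> + \<beta> * t = \<alpha> * (1 + a * t)" using pos by (simp add: a_def field_simps)
    then show ?thesis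
      using \<rho>[OF that] pos a \<gamma> that by (simp add: powr_mult k_def pareto_def)
  qed
  have "(LINT t:{0..}|lebesgue. \<rho> t) = (LINT t:{0..}|lebesgue. k * pareto a \<gamma> t)"
    using proportional by (intro set_lebesgue_integral_cong) auto
  then have "k = 1"
    using is_densityD(3)[OF density] is_densityD(3)[OF is_density_pareto[OF a \<gamma>]] by simp
  with proportional show ?thesis using a \<gamma> by (intro that) auto
qed

lemma power_density_pareto_1_2: "power_density (pareto 1 2)"
  unfolding power_density_def
proof (intro conjI exI)
  show "is_density (pareto 1 2)" by (simp add: is_density_pareto)
  show "\<forall>t\<ge>0. pareto 1 2 t = (1 + 1 * t) powr (- 2)" by (simp add: pareto_def)
qed auto

section \<open>Cutting a density into cells of equal length\<close>

abbreviation cell :: "real \<Rightarrow> nat \<Rightarrow> real set" where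
  "cell \<delta> k \<equiv> {real k * \<delta>..real (Suc k) * \<delta>}"

text \<open>If no mass is left at the start of a cell, \<open>x / 0 = 0\<close> makes its \<open>cell_mass\<close> equal to 1.\<close>

definition cell_mass :: "(real \<Rightarrow> real) \<Rightarrow> real \<Rightarrow> nat \<Rightarrow> real" where
  "cell_mass \<mu> \<delta> k = 1 - tail \<mu> (real (Suc k) * \<delta>) / tail \<mu> (real k * \<delta>)"

text \<open>\<open>b k\<close> stands for the error of the mixed payoff that is used on the \<open>k\<close>-th cell.\<close>

definition accumulated_error :: "(real \<Rightarrow> real) \<Rightarrow> real \<Rightarrow> (nat \<Rightarrow> real) \<Rightarrow> nat \<Rightarrow> real" where
  "accumulated_error \<mu> \<delta> b N = tail \<mu> (real N * \<delta>)
     + (\<Sum>k<N. tail \<mu> (real k * \<delta>) * b k + mean_deviation \<mu> (real k * \<delta>) (real (Suc k) * \<delta>))"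

lemma tail_shift_cell: "tail (shift \<mu> \<delta>) (real k * \<delta>) = tail \<mu> (real (Suc k) * \<delta>) / tail \<mu> \<delta>"
  by (simp add: tail_shift algebra_simps)

lemma cell_mass_between:
  assumes "is_density \<mu>" "\<delta> \<ge> 0"
  shows "0 \<le> cell_mass \<mu> \<delta> k \<and> cell_mass \<mu> \<delta> k \<le> 1"
proof -
  have "0 \<le> tail \<mu> (real (Suc k) * \<delta>)" "tail \<mu> (real (Suc k) * \<delta>) \<le> tail \<mu> (real k * \<delta>)"
    using assms by (auto intro!: tail_nonneg tail_antimono mult_right_mono simp del: of_nat_Suc)
  then show ?thesis by (auto simp: cell_mass_def divide_le_eq_1 simp del: of_nat_Suc)
qed

lemma cell_mass_shift: "tail \<mu> \<delta> \<noteq> 0 \<Longrightarrow> cell_mass (shift \<mu> \<delta>) \<delta> k = cell_mass \<mu> \<delta> (Suc k)"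
  by (simp add: cell_mass_def tail_shift_cell del: of_nat_Suc)

lemma accumulated_error_Suc_ge:
  assumes \<mu>: "is_density \<mu>" and "\<delta> > 0"
  shows "tail \<mu> \<delta> * accumulated_error (shift \<mu> \<delta>) \<delta> (\<lambda>k. b (Suc k)) N + mean_deviation \<mu> 0 \<delta> + b 0
    \<le> accumulated_error \<mu> \<delta> b (Suc N)"
proof -
  let ?rest = "tail \<mu> (real (Suc N) * \<delta>) + (\<Sum>k<N. tail \<mu> (real (Suc k) * \<delta>) * b (Suc k)
    + mean_deviation \<mu> (real (Suc k) * \<delta>) (real (Suc (Suc k)) * \<delta>))"
  have "tail \<mu> \<delta> * accumulated_error (shift \<mu> \<delta>) \<delta> (\<lambda>k. b (Suc k)) N \<le> ?rest"
  proof (cases "tail \<mu> \<delta> = 0")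
    case True
    have "tail \<mu> (real (Suc k) * \<delta>) = 0" for k
      using tail_antimono[OF \<mu>, of \<delta> "real (Suc k) * \<delta>"] tail_nonneg[OF \<mu>, of "real (Suc k) * \<delta>"]
        True \<open>\<delta> > 0\<close> by simp
    then show ?thesis using True by (simp add: sum_nonneg mean_deviation_nonneg del: of_nat_Suc)
  next
    case False
    have "\<bar>tail \<mu> \<delta>\<bar> = tail \<mu> \<delta>" using tail_nonneg[OF \<mu>, of \<delta>] \<open>\<delta> > 0\<close> by simp
    moreover have "\<delta> + real k * \<delta> = real (Suc k) * \<delta>" for k by (simp add: algebra_simps)
    ultimately have "tail \<mu> \<delta> * mean_deviation (shift \<mu> \<delta>) (real k * \<delta>) (real (Suc k) * \<delta>)
        = mean_deviation \<mu> (real (Suc k) * \<delta>) (real (Suc (Suc k)) * \<delta>)" for k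
      using False by (simp add: mean_deviation_shift del: of_nat_Suc)
    then show ?thesis
      using False by (simp add: accumulated_error_def tail_shift_cell distrib_left sum_distrib_left
          mult.assoc[symmetric] del: of_nat_Suc)
  qed
  moreover have "accumulated_error \<mu> \<delta> b (Suc N) = b 0 + mean_deviation \<mu> 0 \<delta> + ?rest"
    by (simp add: accumulated_error_def sum.lessThan_Suc_shift tail_0[OF \<mu>] of_nat_Suc[of 0]
        del: of_nat_Suc sum.lessThan_Suc)
  ultimately show ?thesis by simp
qed

lemma sum_set_integral_cells:
  fixes f :: "real \<Rightarrow> real"
  assumes "\<delta> \<ge> 0"
  shows "set_integrable lebesgue {0..real N * \<delta>} f \<Longrightarrow>
    (\<Sum>k<N. LINT t:cell \<delta> k|lebesgue. f t) = (LINT t:{0..real N * \<delta>}|lebesgue. f t)"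
proof (induction N)
  case 0
  have "(LINT t:{0..0}|lebesgue. f t) = (LINT t:{}|lebesgue. f t)"
    by (rule set_integral_discrete_difference[where X = "{0}"]) auto
  then show ?case by (simp add: set_lebesgue_integral_def)
next
  case (Suc N)
  have endpoints: "0 \<le> real N * \<delta>" "real N * \<delta> \<le> real (Suc N) * \<delta>"
    using assms by (auto simp: algebra_simps)
  then have inter: "{0..real (Suc N) * \<delta>} \<inter> {..real N * \<delta>} = {0..real N * \<delta>}"
    "{0..real (Suc N) * \<delta>} \<inter> {real N * \<delta>..} = cell \<delta> N"
    by auto
  then have "(LINT t:{0..real (Suc N) * \<delta>}|lebesgue. f t)
      = (LINT t:{0..real N * \<delta>}|lebesgue. f t) + (LINT t:cell \<delta> N|lebesgue. f t)"
    using set_integral_split_at[OF Suc.prems, of "real N * \<delta>"] unfolding inter by simp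
  moreover have "set_integrable lebesgue {0..real N * \<delta>} f"
    by (rule set_integrable_subset[OF Suc.prems]) (use endpoints in auto)
  ultimately show ?case using Suc.IH by simp
qed

lemma mean_deviation_le_of_L1_approx:
  assumes f: "set_integrable lebesgue {a..b} f" and g: "set_integrable lebesgue {a..b} g"
    and "a < b" and near: "\<And>t. t \<in> {a..b} \<Longrightarrow> \<bar>g t - c\<bar> \<le> \<eta>"
  shows "mean_deviation f a b \<le> 2 * (LINT t:{a..b}|lebesgue. \<bar>f t - g t\<bar> + \<eta>)"
proof -
  have const: "set_integrable lebesgue {a..b} (\<lambda>_. d)" for d :: real
    by (rule absolutely_integrable_on_const) auto
  have triangle: "\<bar>f t - c\<bar> \<le> \<bar>f t - g t\<bar> + \<eta>" if "t \<in> {a..b}" for t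
    using near[OF that] by linarith
  have "(LINT t:{a..b}|lebesgue. \<bar>f t - c\<bar>) \<le> (LINT t:{a..b}|lebesgue. \<bar>f t - g t\<bar> + \<eta>)"
    by (intro set_integral_mono set_integral_add set_integrable_abs set_integral_diff f g const triangle)
  then show ?thesis
    using mean_deviation_le_L1_dist_const[OF f \<open>a < b\<close>, of c] by simp
qed

lemma sum_mean_deviation_le_of_L1_approx:
  assumes f: "set_integrable lebesgue {0..real N * \<delta>} f"
    and g: "set_integrable lebesgue {0..real N * \<delta>} g"
    and "\<delta> > 0"
    and near: "\<And>k t. k < N \<Longrightarrow> t \<in> cell \<delta> k \<Longrightarrow> \<bar>g t - g (real k * \<delta>)\<bar> \<le> \<eta>"
  shows "(\<Sum>k<N. mean_deviation f (real k * \<delta>) (real (Suc k) * \<delta>))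
    \<le> 2 * ((LINT t:{0..real N * \<delta>}|lebesgue. \<bar>f t - g t\<bar>) + \<eta> * (real N * \<delta>))"
proof -
  have cell_bound: "mean_deviation f (real k * \<delta>) (real (Suc k) * \<delta>)
      \<le> 2 * (LINT t:cell \<delta> k|lebesgue. \<bar>f t - g t\<bar> + \<eta>)" if "k < N" for k
  proof (rule mean_deviation_le_of_L1_approx[OF _ _ _ near[OF that]])
    have "0 \<le> real k * \<delta>" "real (Suc k) * \<delta> \<le> real N * \<delta>"
      using that \<open>\<delta> > 0\<close> by (auto intro!: mult_right_mono simp del: of_nat_Suc)
    then have sub: "cell \<delta> k \<subseteq> {0..real N * \<delta>}" by auto
    show "set_integrable lebesgue (cell \<delta> k) f" "set_integrable lebesgue (cell \<delta> k) g"
      using set_integrable_subset[OF f _ sub] set_integrable_subset[OF g _ sub] by auto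
  qed (use \<open>\<delta> > 0\<close> in auto)
  have diff: "set_integrable lebesgue {0..real N * \<delta>} (\<lambda>t. \<bar>f t - g t\<bar>)"
    by (intro set_integrable_abs set_integral_diff f g)
  have const: "set_integrable lebesgue {0..real N * \<delta>} (\<lambda>_. \<eta>)"
    by (rule absolutely_integrable_on_const) simp
  have "(\<Sum>k<N. mean_deviation f (real k * \<delta>) (real (Suc k) * \<delta>))
      \<le> (\<Sum>k<N. 2 * (LINT t:cell \<delta> k|lebesgue. \<bar>f t - g t\<bar> + \<eta>))"
    using cell_bound by (intro sum_mono) auto
  also have "\<dots> = 2 * (LINT t:{0..real N * \<delta>}|lebesgue. \<bar>f t - g t\<bar> + \<eta>)"
    using sum_set_integral_cells[OF _ set_integral_add(1)[OF diff const]] \<open>\<delta> > 0\<close>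
    by (simp flip: sum_distrib_left)
  also have "\<dots> = 2 * ((LINT t:{0..real N * \<delta>}|lebesgue. \<bar>f t - g t\<bar>) + \<eta> * (real N * \<delta>))"
    using \<open>\<delta> > 0\<close>
    by (simp only: set_integral_add(2)[OF diff const]) (simp add: set_lebesgue_integral_def)
  finally show ?thesis .
qed

lemma ex_accumulated_error_le:
  assumes \<mu>: "is_density \<mu>" and "e > 0"
  obtains \<delta> N where "\<delta> > 0" "accumulated_error \<mu> \<delta> (\<lambda>_. 0) N \<le> e"
proof -
  have "\<forall>\<^sub>F b in at_top. tail \<mu> b < e / 2 \<and> b > 0"
    using tail_tendsto_0[OF \<mu>] \<open>e > 0\<close>
    by (intro eventually_conj order_tendstoD eventually_gt_at_top) auto
  then obtain b where b: "tail \<mu> b < e / 2" "b > 0"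
    using eventually_happens trivial_limit_at_top_linorder by blast
  have integrable_\<mu>: "set_integrable lebesgue {0..b} \<mu>" by (rule set_integrable_density[OF \<mu>]) auto
  obtain g where g: "continuous_on UNIV g" "set_integrable lebesgue {0..b} g"
    "(LINT t:{0..b}|lebesgue. \<bar>\<mu> t - g t\<bar>) < e / 8"
    using set_integrable_approx_continuous_L1[OF _ integrable_\<mu>, of "e / 8"] \<open>e > 0\<close> by auto
  have "uniformly_continuous_on {0..b} g"
    by (rule compact_uniformly_continuous[OF continuous_on_subset[OF g(1)]]) auto
  moreover have "e / (8 * b) > 0" using \<open>e > 0\<close> b by simp
  ultimately obtain d where d: "d > 0"
    "\<And>x y. x \<in> {0..b} \<Longrightarrow> y \<in> {0..b} \<Longrightarrow> \<bar>y - x\<bar> < d \<Longrightarrow> \<bar>g y - g x\<bar> < e / (8 * b)"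
    unfolding uniformly_continuous_on_def dist_real_def by metis
  obtain N where N: "b / d < real N" using reals_Archimedean2 by blast
  define \<delta> where "\<delta> = b / real N"
  have "real N > 0" using N b d by (smt (verit) divide_pos_pos)
  then have \<delta>: "\<delta> > 0" "\<delta> < d" "real N * \<delta> = b"
    using N b d by (auto simp: \<delta>_def field_simps)
  have "(\<Sum>k<N. mean_deviation \<mu> (real k * \<delta>) (real (Suc k) * \<delta>))
      \<le> 2 * ((LINT t:{0..real N * \<delta>}|lebesgue. \<bar>\<mu> t - g t\<bar>) + e / (8 * b) * (real N * \<delta>))"
  proof (rule sum_mean_deviation_le_of_L1_approx)
    fix k t
    assume "k < N" and t: "t \<in> cell \<delta> k"
    then have "real (Suc k) * \<delta> \<le> real N * \<delta>" using \<delta>(1) by (intro mult_right_mono) auto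
    then have "t \<in> {0..b}" "real k * \<delta> \<in> {0..b}" "\<bar>t - real k * \<delta>\<bar> < d"
      using t \<delta> by (auto simp: algebra_simps intro: order_trans[of 0 "real k * \<delta>"])
    then show "\<bar>g t - g (real k * \<delta>)\<bar> \<le> e / (8 * b)" using d(2) by (meson less_imp_le)
  qed (use integrable_\<mu> g \<delta> in auto)
  also have "\<dots> \<le> e / 2" using g(3) b unfolding \<delta>(3) by simp
  finally show ?thesis using \<delta> b(1) by (intro that[of \<delta> N]) (auto simp: accumulated_error_def)
qed

lemma tail_unif_avg_cell:
  assumes "k \<le> n" "n > 0"
  shows "tail (unif_avg 1) (real k * (1 / real n)) = (real n - real k) / real n"
  using assms by (subst tail_unif_avg_1) (auto simp: max_def field_simps)

lemma cell_mass_unif_avg: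
  assumes "k < n"
  shows "cell_mass (unif_avg 1) (1 / real n) k = 1 / (real n - real k)"
proof -
  have "cell_mass (unif_avg 1) (1 / real n) k
      = 1 - (real n - real (Suc k)) / real n / ((real n - real k) / real n)"
    using assms tail_unif_avg_cell[of k n] tail_unif_avg_cell[of "Suc k" n]
    by (simp add: cell_mass_def del: of_nat_Suc)
  also have "\<dots> = 1 / (real n - real k)" using assms by (simp add: field_simps)
  finally show ?thesis .
qed

lemma sum_inverse_diff_eq_harm: "(\<Sum>k<N. 1 / (real (Suc N) - real k)) = harm (Suc N) - 1"
proof -
  have "(\<Sum>k<N. 1 / (real (Suc N) - real k)) = (\<Sum>k<N. inverse (real (Suc (Suc (N - Suc k)))))"
    by (intro sum.cong) (auto simp: of_nat_diff inverse_eq_divide)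
  also have "\<dots> = (\<Sum>k<N. inverse (real (Suc (Suc k))))"
    by (rule sum.nat_diff_reindex)
  also have "\<dots> = harm (Suc N) - 1"
    by (simp add: harm_altdef sum.lessThan_Suc_shift del: sum.lessThan_Suc of_nat_Suc)
  finally show ?thesis .
qed

lemma accumulated_error_unif_avg:
  fixes C :: real and N :: nat
  defines "\<delta> \<equiv> 1 / real (Suc N)"
  shows "accumulated_error (unif_avg 1) \<delta> (\<lambda>k. C * (cell_mass (unif_avg 1) \<delta> k)\<^sup>2) N
    = (1 + C * (harm (Suc N) - 1)) / real (Suc N)"
proof -
  have "tail (unif_avg 1) (real k * \<delta>) * (C * (cell_mass (unif_avg 1) \<delta> k)\<^sup>2)
      + mean_deviation (unif_avg 1) (real k * \<delta>) (real (Suc k) * \<delta>)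
      = C / real (Suc N) * (1 / (real (Suc N) - real k))" if "k < N" for k
  proof -
    have "tail (unif_avg 1) (real k * \<delta>) = (real (Suc N) - real k) / real (Suc N)"
      "cell_mass (unif_avg 1) \<delta> k = 1 / (real (Suc N) - real k)"
      unfolding \<delta>_def using that by (intro tail_unif_avg_cell cell_mass_unif_avg; simp)+
    moreover have "mean_deviation (unif_avg 1) (real k * \<delta>) (real (Suc k) * \<delta>) = 0"
      using that by (intro mean_deviation_unif_avg_1) (auto simp: \<delta>_def divide_strict_right_mono)
    moreover have "real (Suc N) - real k \<noteq> 0" using that by simp
    ultimately show ?thesis by (simp add: power2_eq_square del: of_nat_Suc)
  qed
  then have "accumulated_error (unif_avg 1) \<delta> (\<lambda>k. C * (cell_mass (unif_avg 1) \<delta> k)\<^sup>2) N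
      = tail (unif_avg 1) (real N * \<delta>) + C / real (Suc N) * (\<Sum>k<N. 1 / (real (Suc N) - real k))"
    by (simp add: accumulated_error_def sum_distrib_left)
  also have "tail (unif_avg 1) (real N * \<delta>) = 1 / real (Suc N)"
    using tail_unif_avg_cell[of N "Suc N"] by (simp add: \<delta>_def)
  finally show ?thesis by (simp only: sum_inverse_diff_eq_harm add_divide_distrib times_divide_eq_left)
qed

lemma harm_over_n_tendsto_0: "(\<lambda>n. harm n / real n) \<longlonglongrightarrow> 0"
proof -
  have "(\<lambda>n. (harm n - ln (real n)) * (1 / real n) + ln (real n) / real n) \<longlonglongrightarrow> euler_mascheroni * 0 + 0"
    by (intro tendsto_intros euler_mascheroni_LIMSEQ lim_1_over_n)
  then show ?thesis by (simp add: field_simps flip: add_divide_distrib)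
qed

section \<open>Asymptotic uniform distance\<close>

definition limsup_dist_le ::
  "'s filter \<Rightarrow> ('s \<Rightarrow> 'a \<Rightarrow> 'b::metric_space) \<Rightarrow> ('s \<Rightarrow> 'a \<Rightarrow> 'b) \<Rightarrow> real \<Rightarrow> bool" where
  "limsup_dist_le F f g a \<longleftrightarrow> (\<forall>e>0. \<forall>\<^sub>F s in F. \<forall>x. dist (f s x) (g s x) \<le> a + e)"

lemma limsup_dist_leD:
  "limsup_dist_le F f g a \<Longrightarrow> e > 0 \<Longrightarrow> \<forall>\<^sub>F s in F. \<forall>x. dist (f s x) (g s x) \<le> a + e"
  by (simp add: limsup_dist_le_def)

lemma limsup_dist_leI:
  assumes "\<forall>\<^sub>F s in F. \<forall>x. dist (f s x) (g s x) \<le> a"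
  shows "limsup_dist_le F f g a"
  unfolding limsup_dist_le_def
proof (intro allI impI)
  fix e :: real
  assume "e > 0"
  from assms show "\<forall>\<^sub>F s in F. \<forall>x. dist (f s x) (g s x) \<le> a + e"
    by eventually_elim (use \<open>e > 0\<close> in \<open>meson add_increasing2 less_imp_le\<close>)
qed

lemma limsup_dist_le_mono:
  assumes "limsup_dist_le F f g a" "a \<le> b"
  shows "limsup_dist_le F f g b"
  unfolding limsup_dist_le_def
proof (intro allI impI)
  fix e :: real
  assume "e > 0"
  from limsup_dist_leD[OF assms(1) this]
  show "\<forall>\<^sub>F s in F. \<forall>x. dist (f s x) (g s x) \<le> b + e"
    by eventually_elim (meson assms(2) add_right_mono order_trans)
qed

lemma limsup_dist_le_sym: "limsup_dist_le F f g a \<Longrightarrow> limsup_dist_le F g f a"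
  by (simp add: limsup_dist_le_def dist_commute)

lemma limsup_dist_le_trans:
  assumes "limsup_dist_le F f g a" "limsup_dist_le F g h b"
  shows "limsup_dist_le F f h (a + b)"
  unfolding limsup_dist_le_def
proof (intro allI impI)
  fix e :: real
  assume "e > 0"
  then have "e / 2 > 0" by simp
  from limsup_dist_leD[OF assms(1) this] limsup_dist_leD[OF assms(2) this]
  show "\<forall>\<^sub>F s in F. \<forall>x. dist (f s x) (h s x) \<le> a + b + e"
  proof eventually_elim
    case (elim s)
    show ?case
    proof
      fix x
      have "dist (f s x) (h s x) \<le> dist (f s x) (g s x) + dist (g s x) (h s x)"
        by (rule dist_triangle)
      with elim show "dist (f s x) (h s x) \<le> a + b + e" by (smt (verit) field_sum_of_halves)
    qed
  qed
qed

lemma limsup_dist_le_compose: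
  "limsup_dist_le F f g a \<Longrightarrow> filterlim p F G \<Longrightarrow> limsup_dist_le G (\<lambda>s. f (p s)) (\<lambda>s. g (p s)) a"
  unfolding limsup_dist_le_def filterlim_iff by blast

lemma limsup_dist_le_cong:
  assumes "\<forall>\<^sub>F s in F. f s = f' s" "\<forall>\<^sub>F s in F. g s = g' s"
  shows "limsup_dist_le F f g a \<longleftrightarrow> limsup_dist_le F f' g' a"
proof -
  have "(\<forall>\<^sub>F s in F. \<forall>x. dist (f s x) (g s x) \<le> a + e)
      \<longleftrightarrow> (\<forall>\<^sub>F s in F. \<forall>x. dist (f' s x) (g' s x) \<le> a + e)"
    for e
    using eventually_conj[OF assms] by (intro eventually_subst) (auto elim: eventually_mono)
  then show ?thesis by (simp add: limsup_dist_le_def)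
qed

lemma limsup_dist_le_0_iff_uniform_limit:
  "limsup_dist_le F f (\<lambda>_. l) 0 \<longleftrightarrow> uniform_limit UNIV f l F"
proof
  assume near: "limsup_dist_le F f (\<lambda>_. l) 0"
  show "uniform_limit UNIV f l F"
  proof (rule uniform_limitI)
    fix e :: real
    assume "e > 0"
    then have "\<forall>\<^sub>F s in F. \<forall>x. dist (f s x) (l x) \<le> 0 + e / 2"
      by (intro limsup_dist_leD[OF near]) simp
    then show "\<forall>\<^sub>F s in F. \<forall>x\<in>UNIV. dist (f s x) (l x) < e"
      by eventually_elim (use \<open>e > 0\<close> in \<open>smt (verit) field_sum_of_halves\<close>)
  qed
next
  assume lim: "uniform_limit UNIV f l F"
  show "limsup_dist_le F f (\<lambda>_. l) 0"
    unfolding limsup_dist_le_def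
  proof (intro allI impI)
    fix e :: real
    assume "e > 0"
    from uniform_limitD[OF lim this] show "\<forall>\<^sub>F s in F. \<forall>x. dist (f s x) (l x) \<le> 0 + e"
      by eventually_elim (auto intro: less_imp_le)
  qed
qed

lemma uniform_limitI_limsup_dist_le:
  assumes "\<And>e. e > 0 \<Longrightarrow> limsup_dist_le F f (\<lambda>_. l) e"
  shows "uniform_limit UNIV f l F"
  unfolding limsup_dist_le_0_iff_uniform_limit[symmetric] limsup_dist_le_def
proof (intro allI impI)
  fix e :: real
  assume "e > 0"
  then show "\<forall>\<^sub>F s in F. \<forall>x. dist (f s x) (l x) \<le> 0 + e"
    using limsup_dist_leD[OF assms[of "e / 2"], of "e / 2"] by simp
qed

lemma uniform_limit_in_closed:
  assumes lim: "uniform_limit S f l F" and "F \<noteq> bot" "closed C" "x \<in> S"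
    and "\<forall>\<^sub>F s in F. \<forall>x\<in>S. f s x \<in> C"
  shows "l x \<in> C"
proof (rule Lim_in_closed_set)
  show "((\<lambda>s. f s x) \<longlongrightarrow> l x) F" using lim \<open>x \<in> S\<close> by (rule tendsto_uniform_limitI)
  show "\<forall>\<^sub>F s in F. f s x \<in> C" using assms(5) by eventually_elim (use \<open>x \<in> S\<close> in blast)
qed (fact assms)+

subsection \<open>Convergence of the supremum of the distance\<close>

lemma bdd_above_range_abs_diff:
  fixes f g :: "'a \<Rightarrow> real"
  assumes "bounded (range f)" "bounded (range g)"
  shows "bdd_above (range (\<lambda>x. \<bar>f x - g x\<bar>))"
proof -
  have "bounded ((\<lambda>x. f x - g x) ` UNIV)" by (rule bounded_minus_comp[OF assms])
  then show ?thesis by (auto simp: bounded_iff bdd_above_def)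
qed

lemma unif_lim_iff_uniform_limit:
  fixes U :: "'w \<Rightarrow> real"
  assumes U: "bounded (range U)" and f: "\<forall>\<^sub>F s in F. bounded (range (f s))"
  shows "unif_lim F f U \<longleftrightarrow> uniform_limit UNIV f U F"
proof
  assume "unif_lim F f U"
  then have lim: "((\<lambda>s. SUP \<omega>. \<bar>f s \<omega> - U \<omega>\<bar>) \<longlongrightarrow> 0) F" by (simp add: unif_lim_def)
  show "uniform_limit UNIV f U F"
  proof (rule uniform_limitI)
    fix e :: real
    assume "e > 0"
    from order_tendstoD(2)[OF lim this] f
    show "\<forall>\<^sub>F s in F. \<forall>\<omega>\<in>UNIV. dist (f s \<omega>) (U \<omega>) < e"
    proof eventually_elim
      case (elim s)
      have "\<bar>f s \<omega> - U \<omega>\<bar> \<le> (SUP \<omega>. \<bar>f s \<omega> - U \<omega>\<bar>)" for \<omega>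
        by (rule cSUP_upper[OF UNIV_I bdd_above_range_abs_diff[OF elim(2) U]])
      with elim(1) show ?case by (auto simp: dist_real_def intro: le_less_trans)
    qed
  qed
next
  assume lim: "uniform_limit UNIV f U F"
  show "unif_lim F f U"
    unfolding unif_lim_def
  proof (rule tendstoI)
    fix e :: real
    assume "e > 0"
    then have "\<forall>\<^sub>F s in F. \<forall>\<omega>\<in>UNIV. dist (f s \<omega>) (U \<omega>) < e / 2"
      by (intro uniform_limitD[OF lim]) simp
    with f show "\<forall>\<^sub>F s in F. dist (SUP \<omega>. \<bar>f s \<omega> - U \<omega>\<bar>) 0 < e"
    proof eventually_elim
      case (elim s)
      have "(SUP \<omega>. \<bar>f s \<omega> - U \<omega>\<bar>) \<le> e / 2"
        by (rule cSUP_least) (use elim(2) in \<open>auto simp: dist_real_def intro: less_imp_le\<close>)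
      moreover have "0 \<le> (SUP \<omega>. \<bar>f s \<omega> - U \<omega>\<bar>)"
        by (rule cSUP_upper2[OF bdd_above_range_abs_diff[OF elim(1) U] UNIV_I]) simp
      ultimately show ?case using \<open>e > 0\<close> by simp
    qed
  qed
qed

lemma Sup_real_eq_if_not_bdd_above:
  fixes X Y :: "real set"
  assumes "\<not> bdd_above X" "\<not> bdd_above Y"
  shows "Sup X = Sup Y"
proof -
  have "(\<lambda>z. \<forall>x\<in>X. x \<le> z) = (\<lambda>z. \<forall>y\<in>Y. y \<le> z)"
    using assms unfolding bdd_above_def fun_eq_iff by blast
  then show ?thesis unfolding Sup_real_def by (rule arg_cong)
qed

text \<open>The supremum of an unbounded set of reals is one fixed unspecified number, so for unbounded
  \<open>U\<close> the truth value of \<open>unif_lim\<close> depends on \<open>U\<close> alone.\<close>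

lemma unif_lim_transfer_unbounded:
  fixes U :: "'w \<Rightarrow> real"
  assumes U: "\<not> bounded (range U)" and lim: "unif_lim F f U"
    and f: "\<forall>\<^sub>F s in F. bounded (range (f s))" "F \<noteq> bot" and g: "\<forall>\<^sub>F s in G. bounded (range (g s))"
  shows "unif_lim G g U"
proof -
  define S :: real where "S = Sup UNIV"
  have sup_eq: "(SUP \<omega>. \<bar>h \<omega> - U \<omega>\<bar>) = S" if h: "bounded (range h)" for h
    unfolding S_def
  proof (rule Sup_real_eq_if_not_bdd_above)
    show "\<not> bdd_above (range (\<lambda>\<omega>. \<bar>h \<omega> - U \<omega>\<bar>))"
    proof
      assume "bdd_above (range (\<lambda>\<omega>. \<bar>h \<omega> - U \<omega>\<bar>))"
      then have "bounded (range (\<lambda>\<omega>. h \<omega> - U \<omega>))" by (auto simp: bounded_iff bdd_above_def)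
      from bounded_minus_comp[OF h this] show False using U by simp
    qed
    show "\<not> bdd_above (UNIV :: real set)" by (auto simp: bdd_above_def not_le intro: gt_ex)
  qed
  have "\<forall>\<^sub>F s in F. (SUP \<omega>. \<bar>f s \<omega> - U \<omega>\<bar>) = S" "\<forall>\<^sub>F s in G. (SUP \<omega>. \<bar>g s \<omega> - U \<omega>\<bar>) = S"
    using f(1) g sup_eq by (auto elim: eventually_mono)
  then have "unif_lim F f U \<longleftrightarrow> ((\<lambda>_. S) \<longlongrightarrow> 0) F" "unif_lim G g U \<longleftrightarrow> ((\<lambda>_. S) \<longlongrightarrow> 0) G"
    unfolding unif_lim_def by (auto intro!: tendsto_cong)
  then show ?thesis using lim \<open>F \<noteq> bot\<close> by (simp add: tendsto_const_iff)
qed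

lemma unif_lim_filtermap_iff:
  assumes "filtermap p F = G" "\<forall>\<^sub>F s in F. f s = g (p s)"
  shows "unif_lim F f U \<longleftrightarrow> unif_lim G g U"
proof -
  have "unif_lim F f U \<longleftrightarrow> ((\<lambda>s. SUP \<omega>. \<bar>g (p s) \<omega> - U \<omega>\<bar>) \<longlongrightarrow> 0) F"
    unfolding unif_lim_def using assms(2) by (intro tendsto_cong) (auto elim: eventually_mono)
  also have "\<dots> \<longleftrightarrow> unif_lim G g U"
    by (simp add: unif_lim_def filterlim_filtermap flip: assms(1))
  finally show ?thesis .
qed

lemma filtermap_inverse_affine_at_top:
  fixes a b :: real
  assumes "a > 0"
  shows "filtermap (\<lambda>T. 1 / (b + a * T)) at_top = at_right 0"
proof (rule filtermap_fun_inverse[where g = "\<lambda>l. (1 / l - b) / a"])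
  have affine: "filterlim (\<lambda>x. d + c * x) at_top at_top" if "c > 0" for c d :: real
    by (intro filterlim_tendsto_add_at_top[OF tendsto_const]
        filterlim_tendsto_pos_mult_at_top[OF tendsto_const that] filterlim_ident)
  show "filterlim (\<lambda>T. 1 / (b + a * T)) (at_right 0) at_top"
    using filterlim_compose[OF filterlim_inverse_at_right_top affine[OF assms, of b]]
    by (simp add: inverse_eq_divide)
  have "filterlim (\<lambda>l. - b / a + 1 / a * inverse l) at_top (at_right 0)"
    using assms by (intro filterlim_compose[OF affine filterlim_inverse_at_top_right]) simp
  then show "filterlim (\<lambda>l. (1 / l - b) / a) at_top (at_right 0)"
    by (simp add: divide_inverse algebra_simps)
  show "\<forall>\<^sub>F l in at_right 0. 1 / (b + a * ((1 / l - b) / a)) = l"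
    using assms by (simp add: eventually_at_filter)
qed

lemma filterlim_times_at_right_0: "c > 0 \<Longrightarrow> filterlim (\<lambda>l. c * l) (at_right 0) (at_right (0 :: real))"
  by (rule filterlim_times_pos[where p = 0]) (auto intro: filterlim_ident)

section \<open>Values of games\<close>

locale dpp_game =
  fixes K :: "(real \<Rightarrow> 'w) set"
    and g :: "'w \<Rightarrow> real"
    and V :: "((real \<Rightarrow> 'w) \<Rightarrow> real) \<Rightarrow> 'w \<Rightarrow> real"
  assumes g_range: "\<And>x. 0 \<le> g x \<and> g x \<le> 1"
    and g_meas: "\<And>z. z \<in> K \<Longrightarrow> set_borel_measurable lebesgue {0..} (\<lambda>t. g (z t))"
    and game: "game_mapping K V"
    and dpp: "DPP g V"
begin

lemma V_affine: "bounded (c ` K) \<Longrightarrow> A \<ge> 0 \<Longrightarrow> V (\<lambda>z. A * c z + B) \<omega> = A * V c \<omega> + B"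
  using game unfolding game_mapping_def by metis

lemma V_mono:
  "bounded (c1 ` K) \<Longrightarrow> bounded (c2 ` K) \<Longrightarrow> (\<And>z. z \<in> K \<Longrightarrow> c1 z \<le> c2 z) \<Longrightarrow> V c1 \<omega> \<le> V c2 \<omega>"
  using game unfolding game_mapping_def by blast

lemma V_nonexpansive:
  assumes bounded_c2: "bounded (c2 ` K)" and diff: "\<And>z. z \<in> K \<Longrightarrow> \<bar>c1 z - c2 z\<bar> \<le> e"
  shows "\<bar>V c1 \<omega> - V c2 \<omega>\<bar> \<le> e"
proof -
  have shifted: "bounded ((\<lambda>z. 1 * c2 z + d) ` K)" for d
    using bounded_translation[OF bounded_c2, of d] by (simp add: image_image add.commute)
  have between: "1 * c2 z + (- e) \<le> c1 z" "c1 z \<le> 1 * c2 z + e" if "z \<in> K" for z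
    using diff[OF that] by auto
  obtain m where "\<And>z. z \<in> K \<Longrightarrow> \<bar>c2 z\<bar> \<le> m" using bounded_c2 by (auto simp: bounded_iff)
  then have "\<forall>x\<in>c1 ` K. norm x \<le> m + e" using diff by (force simp: abs_le_iff)
  then have bounded_c1: "bounded (c1 ` K)" unfolding bounded_iff by blast
  have "V (\<lambda>z. 1 * c2 z + (- e)) \<omega> \<le> V c1 \<omega>" "V c1 \<omega> \<le> V (\<lambda>z. 1 * c2 z + e) \<omega>"
    by (intro V_mono shifted bounded_c1 between; assumption)+
  then show ?thesis
    using V_affine[OF bounded_c2, of 1 e \<omega>] V_affine[OF bounded_c2, of 1 "- e" \<omega>] by simp
qed

lemma V_cong:
  assumes "bounded (c2 ` K)" "\<And>z. z \<in> K \<Longrightarrow> c1 z = c2 z"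
  shows "V c1 = V c2"
proof
  fix \<omega>
  show "V c1 \<omega> = V c2 \<omega>" using V_nonexpansive[of c2 c1 0 \<omega>] assms by simp
qed

lemma bounded_image_if_between:
  fixes a b :: real
  assumes "\<And>z. z \<in> K \<Longrightarrow> a \<le> c z \<and> c z \<le> b"
  shows "bounded (c ` K)"
  by (rule bounded_subset[OF bounded_closed_interval[of a b]]) (use assms in auto)

lemma V_between:
  assumes "\<And>z. z \<in> K \<Longrightarrow> a \<le> c z \<and> c z \<le> b"
  shows "a \<le> V c \<omega>" "V c \<omega> \<le> b"
proof -
  have bdd: "bounded (c ` K)" using assms by (rule bounded_image_if_between)
  then have "V (\<lambda>z. 0 * c z + B) \<omega> = B" for B using V_affine[of c 0 B \<omega>] by simp
  moreover have "bounded ((\<lambda>z. 0 * c z + B) ` K)" for B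
    by (rule bounded_image_if_between[of B _ B]) simp
  ultimately show "a \<le> V c \<omega>" "V c \<omega> \<le> b"
    using V_mono[OF _ bdd, of "\<lambda>z. 0 * c z + a" \<omega>] V_mono[OF bdd, of "\<lambda>z. 0 * c z + b" \<omega>] assms
    by auto
qed

subsection \<open>Weighted payoffs\<close>

lemma set_integrable_payoff:
  assumes z: "z \<in> K" and A: "A \<subseteq> {0..}" and \<phi>: "set_integrable lebesgue A \<phi>"
  shows "set_integrable lebesgue A (\<lambda>t. \<phi> t * g (z t))"
proof (rule set_integrable_bound[OF \<phi>])
  have "(\<lambda>t. (indicator A t *\<^sub>R \<phi> t) * (indicator {0..} t *\<^sub>R g (z t))) \<in> borel_measurable lebesgue"
    using borel_measurable_integrable[OF \<phi>[unfolded set_integrable_def]] g_meas[OF z]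
    unfolding set_borel_measurable_def by (rule borel_measurable_times)
  moreover have "(\<lambda>t. indicator A t *\<^sub>R (\<phi> t * g (z t)))
      = (\<lambda>t. (indicator A t *\<^sub>R \<phi> t) * (indicator {0..} t *\<^sub>R g (z t)))"
    using A by (auto simp: indicator_def fun_eq_iff)
  ultimately show "set_borel_measurable lebesgue A (\<lambda>t. \<phi> t * g (z t))"
    by (simp only: set_borel_measurable_def)
  show "AE t in lebesgue. t \<in> A \<longrightarrow> norm (\<phi> t * g (z t)) \<le> norm (\<phi> t)"
    using g_range by (simp add: abs_mult mult_left_le)
qed

lemma payoff_nonneg: "(\<And>t. t \<in> A \<Longrightarrow> \<phi> t \<ge> 0) \<Longrightarrow> 0 \<le> (LINT t:A|M. \<phi> t * g (z t))"
  using g_range by (intro set_integral_nonneg) simp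

lemma payoff_le:
  assumes "z \<in> K" "A \<subseteq> {0..}" "set_integrable lebesgue A \<phi>" "\<And>t. t \<in> A \<Longrightarrow> \<phi> t \<ge> 0"
  shows "(LINT t:A|lebesgue. \<phi> t * g (z t)) \<le> (LINT t:A|lebesgue. \<phi> t)"
  by (rule set_integral_mono[OF set_integrable_payoff[OF assms(1-3)] assms(3)])
     (use assms(4) g_range in \<open>auto simp: mult_left_le\<close>)

lemma payoff_diff_le_L1:
  assumes z: "z \<in> K" and A: "A \<subseteq> {0..}"
    and \<phi>: "set_integrable lebesgue A \<phi>" and \<psi>: "set_integrable lebesgue A \<psi>"
  shows "\<bar>(LINT t:A|lebesgue. \<phi> t * g (z t)) - (LINT t:A|lebesgue. \<psi> t * g (z t))\<bar>
    \<le> (LINT t:A|lebesgue. \<bar>\<phi> t - \<psi> t\<bar>)"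
proof -
  have diff: "set_integrable lebesgue A (\<lambda>t. \<phi> t - \<psi> t)" using \<phi> \<psi> by (rule set_integral_diff)
  have "(LINT t:A|lebesgue. \<phi> t * g (z t)) - (LINT t:A|lebesgue. \<psi> t * g (z t))
      = (LINT t:A|lebesgue. (\<phi> t - \<psi> t) * g (z t))"
    using set_integral_diff(2)[OF set_integrable_payoff[OF z A \<phi>] set_integrable_payoff[OF z A \<psi>]]
    by (simp add: left_diff_distrib)
  also have "\<bar>\<dots>\<bar> \<le> (LINT t:A|lebesgue. \<bar>(\<phi> t - \<psi> t) * g (z t)\<bar>)"
    using set_integral_norm_bound[OF set_integrable_payoff[OF z A diff]] by simp
  also have "\<dots> = (LINT t:A|lebesgue. \<bar>\<phi> t - \<psi> t\<bar> * g (z t))"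
    using g_range by (simp add: abs_mult)
  also have "\<dots> \<le> (LINT t:A|lebesgue. \<bar>\<phi> t - \<psi> t\<bar>)"
    using diff by (intro payoff_le z A set_integrable_abs) auto
  finally show ?thesis .
qed

lemma cost_between:
  assumes "is_density \<rho>" "z \<in> K"
  shows "0 \<le> cost g \<rho> z \<and> cost g \<rho> z \<le> 1"
  using payoff_nonneg[of "{0..}" \<rho>] payoff_le[of z "{0..}" \<rho>] assms
  by (simp add: cost_def is_densityD)

lemma bounded_cost: "is_density \<rho> \<Longrightarrow> bounded (cost g \<rho> ` K)"
  using cost_between by (rule bounded_image_if_between)

lemma val_between: "is_density \<rho> \<Longrightarrow> 0 \<le> val g V \<rho> \<omega> \<and> val g V \<rho> \<omega> \<le> 1"
  unfolding val_def using V_between[of 0 "cost g \<rho>" 1] cost_between by blast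

lemma bounded_range_val: "is_density \<rho> \<Longrightarrow> bounded (range (val g V \<rho>))"
  using val_between by (intro bounded_subset[OF bounded_closed_interval[of 0 1]]) auto

lemma val_cong:
  assumes "\<And>t. t \<ge> 0 \<Longrightarrow> \<rho> t = \<rho>' t"
  shows "val g V \<rho> = val g V \<rho>'"
proof -
  have "cost g \<rho> = cost g \<rho>'"
    unfolding cost_def by (intro ext set_lebesgue_integral_cong) (use assms in auto)
  then show ?thesis by (simp add: val_def)
qed

abbreviation scale_val :: "(real \<Rightarrow> real) \<Rightarrow> real \<Rightarrow> 'w \<Rightarrow> real" where
  "scale_val \<mu> \<equiv> (\<lambda>l. val g V (scale \<mu> l))"

lemma cost_unif_avg:
  assumes "T > 0"
  shows "cost g (unif_avg T) z = (LINT t:{0..T}|lebesgue. 1 / T * g (z t))"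
  unfolding cost_def set_lebesgue_integral_def
  by (intro Bochner_Integration.integral_cong) (auto simp: unif_avg_def indicator_def)

subsection \<open>One step of dynamic programming\<close>

lemma V_dcost:
  assumes \<rho>: "is_density \<rho>" and "T > 0"
  shows "V (dcost g V \<rho> T) = val g V \<rho>"
proof (cases "tail \<rho> T > 0")
  case True
  then show ?thesis using dpp \<rho> \<open>T > 0\<close> by (simp add: DPP_def val_def)
next
  case False
  then have tail: "tail \<rho> T = 0" using tail_nonneg[OF \<rho>, of T] \<open>T > 0\<close> by simp
  have "dcost g V \<rho> T z = cost g \<rho> z" if z: "z \<in> K" for z
  proof -
    have "set_integrable lebesgue {T..} \<rho>" "\<And>t. t \<in> {T..} \<Longrightarrow> \<rho> t \<ge> 0"
      using \<open>T > 0\<close> by (auto intro: set_integrable_density[OF \<rho>] is_densityD(1)[OF \<rho>])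
    then have "(LINT t:{T..}|lebesgue. \<rho> t * g (z t)) = 0"
      using payoff_nonneg[of "{T..}" \<rho>] payoff_le[OF z, of "{T..}" \<rho>] tail \<open>T > 0\<close>
      by (intro antisym) (auto simp: tail_def)
    moreover have "{0..} \<inter> {..T} = {0..T}" "{0..} \<inter> {T..} = {T..}" using \<open>T > 0\<close> by auto
    moreover have "set_integrable lebesgue {0..} (\<lambda>t. \<rho> t * g (z t))"
      by (intro set_integrable_payoff z is_densityD[OF \<rho>]) simp
    ultimately show ?thesis
      using set_integral_split_at[of "{0..}" "\<lambda>t. \<rho> t * g (z t)" T]
      by (simp add: dcost_def cost_def tail)
  qed
  then show ?thesis unfolding val_def by (intro V_cong bounded_cost \<rho>)
qed

definition mixed_payoff :: "('w \<Rightarrow> real) \<Rightarrow> real \<Rightarrow> real \<Rightarrow> (real \<Rightarrow> 'w) \<Rightarrow> real" where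
  "mixed_payoff U h T z = h * cost g (unif_avg T) z + (1 - h) * U (z T)"

lemma head_payoff_dist_le:
  assumes \<rho>: "is_density \<rho>" and "T > 0" and z: "z \<in> K"
  shows "\<bar>(LINT t:{0..T}|lebesgue. \<rho> t * g (z t)) - (1 - tail \<rho> T) * cost g (unif_avg T) z\<bar>
    \<le> mean_deviation \<rho> 0 T"
proof -
  have "(1 - tail \<rho> T) * cost g (unif_avg T) z
      = (LINT t:{0..T}|lebesgue. (1 - tail \<rho> T) * (1 / T * g (z t)))"
    unfolding cost_unif_avg[OF \<open>T > 0\<close>] by (rule set_integral_mult_right[symmetric])
  also have "\<dots> = (LINT t:{0..T}|lebesgue. (1 - tail \<rho> T) / T * g (z t))" by simp
  finally show ?thesis
    using payoff_diff_le_L1[OF z, of "{0..T}" \<rho> "\<lambda>_. (1 - tail \<rho> T) / T"] \<open>T > 0\<close>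
      set_integral_density_Icc[OF \<rho>, of T] set_integrable_density[OF \<rho>, of "{0..T}"]
      absolutely_integrable_on_const[of "{0..T}"]
    by (simp add: mean_deviation_def)
qed

context
  fixes U :: "'w \<Rightarrow> real"
  assumes U: "\<And>\<omega>. 0 \<le> U \<omega> \<and> U \<omega> \<le> 1"
begin

lemma mixed_payoff_between:
  assumes "T > 0" "0 \<le> h" "h \<le> 1" "z \<in> K"
  shows "0 \<le> mixed_payoff U h T z \<and> mixed_payoff U h T z \<le> 1"
proof -
  have "mixed_payoff U h T z \<le> h * 1 + (1 - h) * 1"
    using cost_between[OF is_density_unif_avg] U assms
    unfolding mixed_payoff_def by (intro add_mono mult_left_mono) auto
  then show ?thesis
    using cost_between[OF is_density_unif_avg] U assms by (simp add: mixed_payoff_def)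
qed

lemma bounded_mixed_payoff:
  assumes "T > 0" "0 \<le> h" "h \<le> 1"
  shows "bounded (mixed_payoff U h T ` K)"
  using mixed_payoff_between[OF assms] by (rule bounded_image_if_between)

lemma V_mixed_payoff_lipschitz:
  assumes "T > 0" "0 \<le> k" "k \<le> 1"
  shows "\<bar>V (mixed_payoff U h T) \<omega> - V (mixed_payoff U k T) \<omega>\<bar> \<le> \<bar>h - k\<bar>"
proof (rule V_nonexpansive[OF bounded_mixed_payoff[OF assms]])
  fix z
  assume "z \<in> K"
  then have "\<bar>cost g (unif_avg T) z - U (z T)\<bar> \<le> 1"
    using cost_between[OF is_density_unif_avg[OF \<open>T > 0\<close>]] U[of "z T"] by fastforce
  moreover have "mixed_payoff U h T z - mixed_payoff U k T z
      = (h - k) * (cost g (unif_avg T) z - U (z T))"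
    by (simp add: mixed_payoff_def algebra_simps)
  ultimately show "\<bar>mixed_payoff U h T z - mixed_payoff U k T z\<bar> \<le> \<bar>h - k\<bar>"
    by (simp add: abs_mult mult_left_le)
qed

lemma val_mixed_payoff_dist_le:
  assumes \<rho>: "is_density \<rho>" and "T > 0"
    and near: "\<And>\<omega>. tail \<rho> T > 0 \<Longrightarrow> \<bar>val g V (shift \<rho> T) \<omega> - U \<omega>\<bar> \<le> e"
  shows "\<bar>val g V \<rho> \<omega> - V (mixed_payoff U (1 - tail \<rho> T) T) \<omega>\<bar> \<le> tail \<rho> T * e + mean_deviation \<rho> 0 T"
proof -
  have tail: "0 \<le> tail \<rho> T" "tail \<rho> T \<le> 1"
    using tail_nonneg[OF \<rho>] tail_le_1[OF \<rho>] \<open>T > 0\<close> by auto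
  have "\<bar>dcost g V \<rho> T z - mixed_payoff U (1 - tail \<rho> T) T z\<bar> \<le> tail \<rho> T * e + mean_deviation \<rho> 0 T"
    if z: "z \<in> K" for z
  proof -
    have "\<bar>tail \<rho> T * (val g V (shift \<rho> T) (z T) - U (z T))\<bar> \<le> tail \<rho> T * e"
      using near[of "z T"] tail by (cases "tail \<rho> T = 0") (auto simp: abs_mult)
    moreover have "dcost g V \<rho> T z - mixed_payoff U (1 - tail \<rho> T) T z
        = (LINT t:{0..T}|lebesgue. \<rho> t * g (z t)) - (1 - tail \<rho> T) * cost g (unif_avg T) z
          + tail \<rho> T * (val g V (shift \<rho> T) (z T) - U (z T))"
      by (simp add: dcost_def mixed_payoff_def val_def algebra_simps)
    ultimately show ?thesis using head_payoff_dist_le[OF \<rho> \<open>T > 0\<close> z] by linarith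
  qed
  moreover have "bounded (mixed_payoff U (1 - tail \<rho> T) T ` K)"
    using tail \<open>T > 0\<close> by (intro bounded_mixed_payoff) auto
  ultimately show ?thesis
    unfolding V_dcost[OF \<rho> \<open>T > 0\<close>, symmetric] by (intro V_nonexpansive)
qed

section \<open>Limits of values of rescaled densities\<close>

abbreviation mixed_val :: "real \<Rightarrow> real \<Rightarrow> real \<Rightarrow> 'w \<Rightarrow> real" where
  "mixed_val h s \<equiv> (\<lambda>l. V (mixed_payoff U h (s / l)))"

abbreviation limit_within :: "(real \<Rightarrow> 'w \<Rightarrow> real) \<Rightarrow> real \<Rightarrow> bool" where
  "limit_within f a \<equiv> limsup_dist_le (at_right 0) f (\<lambda>_. U) a"

abbreviation limit :: "(real \<Rightarrow> 'w \<Rightarrow> real) \<Rightarrow> bool" where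
  "limit f \<equiv> uniform_limit UNIV f U (at_right 0)"

lemma limsup_dist_scale_val_mixed_val:
  assumes \<mu>: "is_density \<mu>" and "s > 0"
    and shift: "tail \<mu> s > 0 \<Longrightarrow> limit_within (scale_val (shift \<mu> s)) a"
  shows "limsup_dist_le (at_right 0) (scale_val \<mu>) (mixed_val (1 - tail \<mu> s) s)
    (tail \<mu> s * a + mean_deviation \<mu> 0 s)"
  unfolding limsup_dist_le_def
proof (intro allI impI)
  fix e :: real
  assume "e > 0"
  have "\<forall>\<^sub>F l in at_right 0. tail \<mu> s > 0 \<longrightarrow> (\<forall>\<omega>. \<bar>scale_val (shift \<mu> s) l \<omega> - U \<omega>\<bar> \<le> a + e)"
    using limsup_dist_leD[OF shift \<open>e > 0\<close>] by (cases "tail \<mu> s > 0") (auto simp: dist_real_def)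
  with eventually_at_right_less[of 0]
  show "\<forall>\<^sub>F l in at_right 0. \<forall>\<omega>. dist (scale_val \<mu> l \<omega>) (mixed_val (1 - tail \<mu> s) s l \<omega>)
    \<le> tail \<mu> s * a + mean_deviation \<mu> 0 s + e"
  proof eventually_elim
    case (elim l)
    have "l * (s / l) = s" using elim(1) by simp
    then have scaled: "tail (scale \<mu> l) (s / l) = tail \<mu> s"
      "shift (scale \<mu> l) (s / l) = scale (shift \<mu> s) l"
      "mean_deviation (scale \<mu> l) 0 (s / l) = mean_deviation \<mu> 0 s"
      using elim(1) by (simp_all add: tail_scale shift_scale mean_deviation_scale)
    have weight: "tail \<mu> s * (a + e) \<le> tail \<mu> s * a + e"
      using tail_le_1[OF \<mu>, of s] \<open>s > 0\<close> \<open>e > 0\<close> by (simp add: distrib_left mult_le_cancel_right1)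
    show ?case
    proof
      fix \<omega>
      have "\<bar>scale_val \<mu> l \<omega> - mixed_val (1 - tail \<mu> s) s l \<omega>\<bar>
          \<le> tail \<mu> s * (a + e) + mean_deviation \<mu> 0 s"
        using val_mixed_payoff_dist_le[OF is_density_scale[OF \<mu> elim(1)],
            where T = "s / l" and e = "a + e"] elim \<open>s > 0\<close> by (simp add: scaled)
      with weight show "dist (scale_val \<mu> l \<omega>) (mixed_val (1 - tail \<mu> s) s l \<omega>)
          \<le> tail \<mu> s * a + mean_deviation \<mu> 0 s + e"
        unfolding dist_real_def by linarith
    qed
  qed
qed

lemma mixed_val_limit_within_rescale:
  assumes "limit_within (mixed_val h s) b" "s > 0" "s' > 0"
  shows "limit_within (mixed_val h s') b"
  using limsup_dist_le_compose[OF assms(1) filterlim_times_at_right_0[of "s / s'"]] assms(2,3) by simp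

lemma mixed_val_limit_within_of_self_similar:
  assumes \<mu>: "self_similar \<mu>" and lim: "limit (scale_val \<mu>)" and s: "s > 0" "tail \<mu> s > 0"
  shows "limit_within (mixed_val (1 - tail \<mu> s) 1) (mean_deviation \<mu> 0 s)"
proof -
  have density: "is_density \<mu>" using \<mu> by (simp add: self_similar_def)
  obtain r where r: "r > 0" "\<And>t. t \<ge> 0 \<Longrightarrow> shift \<mu> s t = scale \<mu> r t"
    using \<mu> s unfolding self_similar_def by (meson less_imp_le)
  have lim0: "limit_within (scale_val \<mu>) 0"
    using lim by (simp add: limsup_dist_le_0_iff_uniform_limit)
  from limsup_dist_le_compose[OF this filterlim_times_at_right_0[OF r(1)]]
  have "limit_within (scale_val (scale \<mu> r)) 0" by (simp add: scale_scale)
  moreover have "\<forall>\<^sub>F l in at_right 0. scale_val (scale \<mu> r) l = scale_val (shift \<mu> s) l"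
    using eventually_at_right_less[of 0]
    by eventually_elim (auto intro!: val_cong simp: scale_def[of _ "_ :: real"] r(2))
  ultimately have "limit_within (scale_val (shift \<mu> s)) 0"
    by (simp add: limsup_dist_le_cong[where g' = "\<lambda>_. U"])
  from limsup_dist_le_sym[OF limsup_dist_scale_val_mixed_val[OF density s(1) this]] lim0
  have "limit_within (mixed_val (1 - tail \<mu> s) s) (mean_deviation \<mu> 0 s)"
    using limsup_dist_le_trans by fastforce
  then show ?thesis using s(1) by (rule mixed_val_limit_within_rescale) simp
qed

lemma scale_val_limit_within_1:
  assumes "is_density \<mu>"
  shows "limit_within (scale_val \<mu>) 1"
proof (rule limsup_dist_leI)
  have dist_le: "dist (val g V \<rho> \<omega>) (U \<omega>) \<le> 1" if "is_density \<rho>" for \<rho> \<omega>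
    using val_between[OF that, of \<omega>] U[of \<omega>] by (simp add: dist_real_def abs_le_iff)
  show "\<forall>\<^sub>F l in at_right 0. \<forall>\<omega>. dist (scale_val \<mu> l \<omega>) (U \<omega>) \<le> 1"
    using eventually_at_right_less[of 0] by eventually_elim (intro allI dist_le is_density_scale assms)
qed

lemma scale_val_limit_within_of_mixed_vals:
  assumes "\<delta> > 0"
  shows "is_density \<mu> \<Longrightarrow> (\<And>k. k < N \<Longrightarrow> limit_within (mixed_val (cell_mass \<mu> \<delta> k) 1) (b k)) \<Longrightarrow>
    limit_within (scale_val \<mu>) (accumulated_error \<mu> \<delta> b N)"
proof (induction N arbitrary: \<mu> b)
  case 0
  then show ?case using scale_val_limit_within_1 by (simp add: accumulated_error_def tail_0)
next
  case (Suc N)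
  note \<mu> = Suc.prems(1)
  have "limit_within (scale_val (shift \<mu> \<delta>)) (accumulated_error (shift \<mu> \<delta>) \<delta> (\<lambda>k. b (Suc k)) N)"
    if "tail \<mu> \<delta> > 0"
  proof (rule Suc.IH)
    show "is_density (shift \<mu> \<delta>)" using \<mu> that \<open>\<delta> > 0\<close> by (intro is_density_shift) auto
    show "limit_within (mixed_val (cell_mass (shift \<mu> \<delta>) \<delta> k) 1) (b (Suc k))" if "k < N" for k
      using Suc.prems(2)[of "Suc k"] that \<open>tail \<mu> \<delta> > 0\<close> by (simp add: cell_mass_shift)
  qed
  note limsup_dist_scale_val_mixed_val[OF \<mu> \<open>\<delta> > 0\<close> this]
  moreover have "limit_within (mixed_val (1 - tail \<mu> \<delta>) \<delta>) (b 0)"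
    using mixed_val_limit_within_rescale[OF Suc.prems(2)[of 0] zero_less_one \<open>\<delta> > 0\<close>]
    by (simp add: cell_mass_def tail_0[OF \<mu>])
  ultimately have "limit_within (scale_val \<mu>)
      (tail \<mu> \<delta> * accumulated_error (shift \<mu> \<delta>) \<delta> (\<lambda>k. b (Suc k)) N + mean_deviation \<mu> 0 \<delta> + b 0)"
    by (rule limsup_dist_le_trans)
  then show ?case
    by (rule limsup_dist_le_mono[OF _ accumulated_error_Suc_ge[OF \<mu> \<open>\<delta> > 0\<close>]])
qed

lemma unif_avg_limit_of_quadratic:
  assumes quadratic: "\<And>h. 0 < h \<Longrightarrow> h < 1 \<Longrightarrow> limit_within (mixed_val h 1) (C * h\<^sup>2)"
  shows "limit (scale_val (unif_avg 1))"
proof (rule uniform_limitI_limsup_dist_le)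
  fix e :: real
  assume "e > 0"
  have "(\<lambda>n. (1 - C) * (1 / real n) + C * (harm n / real n)) \<longlonglongrightarrow> (1 - C) * 0 + C * 0"
    by (intro tendsto_intros lim_1_over_n harm_over_n_tendsto_0)
  then have "(\<lambda>n. (1 + C * (harm n - 1)) / real n) \<longlonglongrightarrow> 0"
    by (simp add: field_simps flip: add_divide_distrib diff_divide_distrib)
  then have "\<forall>\<^sub>F n in sequentially. (1 + C * (harm (Suc n) - 1)) / real (Suc n) < e"
    using \<open>e > 0\<close> by (intro order_tendstoD LIMSEQ_Suc) auto
  then obtain N where N: "(1 + C * (harm (Suc N) - 1)) / real (Suc N) < e"
    using eventually_happens trivial_limit_sequentially by blast
  define \<delta> where "\<delta> = 1 / real (Suc N)"
  have "limit_within (scale_val (unif_avg 1))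
      (accumulated_error (unif_avg 1) \<delta> (\<lambda>k. C * (cell_mass (unif_avg 1) \<delta> k)\<^sup>2) N)"
  proof (rule scale_val_limit_within_of_mixed_vals)
    fix k
    assume "k < N"
    then have "0 < cell_mass (unif_avg 1) \<delta> k" "cell_mass (unif_avg 1) \<delta> k < 1"
      using cell_mass_unif_avg[of k "Suc N"] by (auto simp: \<delta>_def simp del: of_nat_Suc)
    then show "limit_within (mixed_val (cell_mass (unif_avg 1) \<delta> k) 1)
      (C * (cell_mass (unif_avg 1) \<delta> k)\<^sup>2)" by (rule quadratic)
  qed (simp_all add: \<delta>_def is_density_unif_avg_1)
  then show "limit_within (scale_val (unif_avg 1)) e"
    using N unfolding \<delta>_def accumulated_error_unif_avg by (elim limsup_dist_le_mono) simp
qed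

lemma mixed_val_limit_of_unif_avg:
  assumes lim: "limit (scale_val (unif_avg 1))" and h: "0 \<le> h" "h \<le> 1"
  shows "limit (mixed_val h 1)"
proof (rule uniform_limitI_limsup_dist_le)
  fix e :: real
  assume "e > 0"
  define d where "d = min e (1 / 2)"
  define k where "k = max (d / 2) (min (1 - d / 2) h)"
  have k: "0 < k" "k < 1" "\<bar>h - k\<bar> \<le> e"
    using \<open>e > 0\<close> h by (auto simp: k_def d_def)
  have "\<forall>\<^sub>F l in at_right 0. \<forall>\<omega>. dist (mixed_val h 1 l \<omega>) (mixed_val k 1 l \<omega>) \<le> e"
    using eventually_at_right_less[of 0]
  proof eventually_elim
    case (elim l)
    then show ?case
      using k by (auto simp: dist_real_def intro!: order_trans[OF V_mixed_payoff_lipschitz])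
  qed
  then have "limsup_dist_le (at_right 0) (mixed_val h 1) (mixed_val k 1) e"
    by (rule limsup_dist_leI)
  moreover have "limit_within (mixed_val k 1) 0"
    using mixed_val_limit_within_of_self_similar[OF self_similar_unif_avg_1 lim, of k] k
    by (simp add: tail_unif_avg_1 mean_deviation_unif_avg_1)
  ultimately show "limit_within (mixed_val h 1) e"
    using limsup_dist_le_trans by fastforce
qed

lemma scale_val_limit_of_unif_avg:
  assumes lim: "limit (scale_val (unif_avg 1))" and \<mu>: "is_density \<mu>"
  shows "limit (scale_val \<mu>)"
proof (rule uniform_limitI_limsup_dist_le)
  fix e :: real
  assume "e > 0"
  then obtain \<delta> N where \<delta>: "\<delta> > 0" and error: "accumulated_error \<mu> \<delta> (\<lambda>_. 0) N \<le> e"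
    using ex_accumulated_error_le[OF \<mu>] by blast
  have "limit_within (mixed_val (cell_mass \<mu> \<delta> k) 1) 0" for k
    unfolding limsup_dist_le_0_iff_uniform_limit
    using cell_mass_between[OF \<mu>, of \<delta> k] \<delta> by (intro mixed_val_limit_of_unif_avg lim) auto
  then have "limit_within (scale_val \<mu>) (accumulated_error \<mu> \<delta> (\<lambda>_. 0) N)"
    by (intro scale_val_limit_within_of_mixed_vals[OF \<delta> \<mu>])
  then show "limit_within (scale_val \<mu>) e"
    using error by (rule limsup_dist_le_mono)
qed

lemma scale_val_limit_of_tauberian:
  assumes \<mu>: "tauberian_density \<mu>" and lim: "limit (scale_val \<mu>)" and \<nu>: "is_density \<nu>"
  shows "limit (scale_val \<nu>)"
proof (rule scale_val_limit_of_unif_avg[OF _ \<nu>])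
  obtain C where sim: "self_similar \<mu>"
    and C: "\<And>s. s > 0 \<Longrightarrow> tail \<mu> s > 0 \<Longrightarrow> mean_deviation \<mu> 0 s \<le> C * (1 - tail \<mu> s)\<^sup>2"
    using \<mu> by (auto simp: tauberian_density_def)
  show "limit (scale_val (unif_avg 1))"
  proof (rule unif_avg_limit_of_quadratic)
    fix h :: real
    assume "0 < h" "h < 1"
    then obtain s where s: "s > 0" "tail \<mu> s = 1 - h"
      using ex_tail_eq[OF tauberian_density_is_density[OF \<mu>], of "1 - h"] by auto
    then have "tail \<mu> s > 0" using \<open>h < 1\<close> by simp
    from mixed_val_limit_within_of_self_similar[OF sim lim s(1) this] C[OF s(1) this]
    have "limit_within (mixed_val (1 - tail \<mu> s) 1) (C * (1 - tail \<mu> s)\<^sup>2)"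
      by (rule limsup_dist_le_mono)
    then show "limit_within (mixed_val h 1) (C * h\<^sup>2)" by (simp add: s(2))
  qed
qed

end

section \<open>Equivalence of the limits\<close>

abbreviation scale_lim :: "(real \<Rightarrow> real) \<Rightarrow> ('w \<Rightarrow> real) \<Rightarrow> bool" where
  "scale_lim \<mu> \<equiv> unif_lim (at_right 0) (scale_val \<mu>)"

lemma scale_lim_of_tauberian:
  assumes \<mu>: "tauberian_density \<mu>" and lim: "scale_lim \<mu> U" and \<nu>: "is_density \<nu>"
  shows "scale_lim \<nu> U"
proof -
  have density: "is_density \<mu>" using \<mu> by (rule tauberian_density_is_density)
  have eventually_bounded: "\<forall>\<^sub>F l in at_right 0. bounded (range (scale_val \<rho> l))"
    if "is_density \<rho>" for \<rho>
    using eventually_at_right_less[of 0]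
    by eventually_elim (intro bounded_range_val is_density_scale that)
  show ?thesis
  proof (cases "bounded (range U)")
    case True
    then have unif_lim_iff: "scale_lim \<rho> U \<longleftrightarrow> uniform_limit UNIV (scale_val \<rho>) U (at_right 0)"
      if "is_density \<rho>" for \<rho>
      using eventually_bounded[OF that] by (rule unif_lim_iff_uniform_limit)
    have ulim: "uniform_limit UNIV (scale_val \<mu>) U (at_right 0)"
      using lim unif_lim_iff[OF density] by simp
    have "\<forall>\<^sub>F l in at_right 0. \<forall>\<omega>\<in>UNIV. scale_val \<mu> l \<omega> \<in> {0..1}"
      using eventually_at_right_less[of 0]
      by eventually_elim (simp add: val_between is_density_scale density)
    then have "U \<omega> \<in> {0..1}" for \<omega>
      by (rule uniform_limit_in_closed[OF ulim trivial_limit_at_right_real closed_atLeastAtMost UNIV_I])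
    then have "uniform_limit UNIV (scale_val \<nu>) U (at_right 0)"
      using scale_val_limit_of_tauberian[of U, OF _ \<mu> ulim \<nu>] by simp
    then show ?thesis using unif_lim_iff[OF \<nu>] by simp
  next
    case False
    show ?thesis
      by (rule unif_lim_transfer_unbounded[OF False lim eventually_bounded[OF density]
            trivial_limit_at_right_real eventually_bounded[OF \<nu>]])
  qed
qed

lemma scale_lim_tauberian_iff:
  "tauberian_density \<mu> \<Longrightarrow> tauberian_density \<nu> \<Longrightarrow> scale_lim \<mu> U \<longleftrightarrow> scale_lim \<nu> U"
  using scale_lim_of_tauberian tauberian_density_is_density by metis

lemma unif_lim_expd_iff: "unif_lim (at_right 0) (\<lambda>l. val g V (expd l)) U \<longleftrightarrow> scale_lim (expd 1) U"
  by (simp flip: expd_eq_scale)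

lemma unif_lim_unif_avg_iff: "unif_lim at_top (\<lambda>T. val g V (unif_avg T)) U \<longleftrightarrow> scale_lim (unif_avg 1) U"
proof (rule unif_lim_filtermap_iff)
  show "filtermap (\<lambda>T. 1 / T) at_top = at_right (0 :: real)"
    using filtermap_inverse_affine_at_top[of 1 0] by simp
  show "\<forall>\<^sub>F T in at_top. val g V (unif_avg T) = scale_val (unif_avg 1) (1 / T)"
    using eventually_gt_at_top[of 0] by eventually_elim (rule arg_cong[OF unif_avg_eq_scale])
qed

lemma unif_lim_shift_pareto_iff:
  assumes "a > 0" "\<gamma> > 1"
  shows "unif_lim at_top (\<lambda>T. val g V (shift (pareto a \<gamma>) T)) U \<longleftrightarrow> scale_lim (pareto a \<gamma>) U"
proof (rule unif_lim_filtermap_iff)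
  show "filtermap (\<lambda>T. 1 / (1 + a * T)) at_top = at_right 0"
    using assms(1) by (rule filtermap_inverse_affine_at_top)
  show "\<forall>\<^sub>F T in at_top. val g V (shift (pareto a \<gamma>) T) = scale_val (pareto a \<gamma>) (1 / (1 + a * T))"
    using eventually_ge_at_top[of 0] by eventually_elim (intro val_cong shift_pareto assms)
qed

lemma unif_lim_shift_power_density_iff:
  assumes "power_density \<rho>"
  shows "unif_lim at_top (\<lambda>T. val g V (shift \<rho> T)) U \<longleftrightarrow> scale_lim (expd 1) U"
proof -
  obtain a \<gamma> where a: "a > 0" "\<gamma> > 1" and \<rho>: "\<And>t. t \<ge> 0 \<Longrightarrow> \<rho> t = pareto a \<gamma> t"
    using power_density_eq_pareto[OF assms] by blast
  have "\<forall>\<^sub>F T in at_top. val g V (shift \<rho> T) = val g V (shift (pareto a \<gamma>) T)"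
    using eventually_ge_at_top[of 0] by eventually_elim (intro val_cong shift_cong \<rho>)
  then have "unif_lim at_top (\<lambda>T. val g V (shift \<rho> T)) U \<longleftrightarrow> scale_lim (pareto a \<gamma>) U"
    by (simp add: unif_lim_filtermap_iff[OF filtermap_ident] unif_lim_shift_pareto_iff[OF a])
  also have "\<dots> \<longleftrightarrow> scale_lim (expd 1) U"
    using tauberian_pareto[OF a] tauberian_expd by (rule scale_lim_tauberian_iff)
  finally show ?thesis .
qed

end

theorem theorem1:
  fixes K :: "(real \<Rightarrow> 'w) set"
    and g :: "'w \<Rightarrow> real"
    and V :: "((real \<Rightarrow> 'w) \<Rightarrow> real) \<Rightarrow> 'w \<Rightarrow> real"
  assumes K_ne: "K \<noteq> {}"
    and g_range: "\<And>x. 0 \<le> g x \<and> g x \<le> 1"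
    and g_meas: "\<And>z. z \<in> K \<Longrightarrow> set_borel_measurable lebesgue {0..} (\<lambda>t. g (z t))"
    and game: "game_mapping K V"
    and dpp: "DPP g V"
  shows
   "(\<forall>U :: 'w \<Rightarrow> real. (\<forall>\<omega>. 0 \<le> U \<omega> \<and> U \<omega> \<le> 1) \<longrightarrow>
      (let
         cC = (\<forall>\<mu>. is_density \<mu> \<and> pw_continuous_pos \<mu> \<longrightarrow>
                  unif_lim (at_right 0) (\<lambda>l. val g V (scale \<mu> l)) U);
         cU = unif_lim at_top (\<lambda>T. val g V (unif_avg T)) U;
         cE = unif_lim (at_right 0) (\<lambda>l. val g V (expd l)) U;
         cP = (\<exists>\<rho>. power_density \<rho> \<and> unif_lim at_top (\<lambda>T. val g V (shift \<rho> T)) U);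
         cQ = (\<forall>\<rho>. power_density \<rho> \<longrightarrow> unif_lim at_top (\<lambda>T. val g V (shift \<rho> T)) U)
       in (cC \<longleftrightarrow> cU) \<and> (cU \<longleftrightarrow> cE) \<and> (cE \<longleftrightarrow> cP) \<and> (cP \<longleftrightarrow> cQ)))
    \<and>
    (\<forall>\<mu> \<rho>. is_density \<mu> \<and> pw_continuous_pos \<mu> \<and> power_density \<rho> \<longrightarrow>
      ((\<exists>U. unif_lim at_top (\<lambda>T. val g V (unif_avg T)) U) \<or>
       (\<exists>U. unif_lim (at_right 0) (\<lambda>l. val g V (expd l)) U) \<or>
       (\<exists>U. unif_lim at_top (\<lambda>T. val g V (shift \<rho> T)) U)) \<longrightarrow>
      (\<exists>U. unif_lim at_top (\<lambda>T. val g V (unif_avg T)) U \<and>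
           unif_lim (at_right 0) (\<lambda>l. val g V (expd l)) U \<and>
           unif_lim at_top (\<lambda>T. val g V (shift \<rho> T)) U \<and>
           unif_lim (at_right 0) (\<lambda>l. val g V (scale \<mu> l)) U \<and>
           (\<forall>\<mu>' \<rho>'. is_density \<mu>' \<and> pw_continuous_pos \<mu>' \<and> power_density \<rho>' \<longrightarrow>
              unif_lim at_top (\<lambda>T. val g V (shift \<rho>' T)) U \<and>
              unif_lim (at_right 0) (\<lambda>l. val g V (scale \<mu>' l)) U)))"
proof -
  interpret dpp_game K g V
    by unfold_locales (fact g_range g_meas game dpp)+
  have unif_avg: "unif_lim at_top (\<lambda>T. val g V (unif_avg T)) U \<longleftrightarrow> scale_lim (expd 1) U" for U
    using unif_lim_unif_avg_iff scale_lim_tauberian_iff[OF tauberian_unif_avg_1 tauberian_expd] by simp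
  have all_densities: "(\<forall>\<mu>. is_density \<mu> \<and> pw_continuous_pos \<mu> \<longrightarrow> scale_lim \<mu> U)
      \<longleftrightarrow> scale_lim (expd 1) U" for U
    using scale_lim_of_tauberian[OF tauberian_expd] is_density_expd pw_continuous_pos_expd by blast
  have some_power: "(\<exists>\<rho>. power_density \<rho> \<and> unif_lim at_top (\<lambda>T. val g V (shift \<rho> T)) U)
      \<longleftrightarrow> scale_lim (expd 1) U" for U
    using unif_lim_shift_power_density_iff power_density_pareto_1_2 by blast
  have all_powers: "(\<forall>\<rho>. power_density \<rho> \<longrightarrow> unif_lim at_top (\<lambda>T. val g V (shift \<rho> T)) U)
      \<longleftrightarrow> scale_lim (expd 1) U" for U
    using unif_lim_shift_power_density_iff power_density_pareto_1_2 by blast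
  show ?thesis
    unfolding Let_def unif_avg unif_lim_expd_iff all_densities some_power all_powers
    using all_densities unif_lim_shift_power_density_iff by blast
qed

end
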